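(* The moduli space $\mathcal{M}_3^{\mathrm{trop}}$ of degree-$3$ tropical rational maps up to post-composition admits a stratification according to the automorphism group $\mathrm{Aut}(\varphi)$: (i) Generic stratum (dimension $4$): maps with trivial automorphism group. (ii) Symmetric stratum (dimension $3$): maps with automorphism group $\mathbb{Z}/2\mathbb{Z}$, defined in the maximal cones of palindromic types (slope sequences with four break points invariant under reversal) by the linear condition $\ell_1=\ell_3$. (iii) Symmetric boundary (dimension $2$): the two-break-point types $(3,5,3)$ and $(3,1,3)$, whose parameter spaces are $2$-dimensional and which are automatically symmetric (automorphism group $\mathbb{Z}/2\mathbb{Z}$).
   Context: The tropical projective line is $\mathbb{T}\mathbb{P}^1=\mathbb{R}\cup\{-\infty,+\infty\}$; its automorphism group $\mathrm{Aut}(\mathbb{T}\mathbb{P}^1)$ consists of the maps $x\mapsto\varepsilon x+b$, $\varepsilon\in\{\pm1\}$, $b\in\mathbb{R}$. A degree-$3$ tropical rational map is a continuous piecewise-linear function $\varphi:\mathbb{R}\to\mathbb{R}$ (extended to $\mathbb{T}\mathbb{P}^1\to\mathbb{T}\mathbb{P}^1$) with integer slopes and finitely many break points $x_1<\dots<x_k$ whose slope sequence $(s_0,\dots,s_k)$ ($s_i$ the slope on $(x_i,x_{i+1})$, $x_0=-\infty$, $x_{k+1}=+\infty$, consecutive slopes distinct) satisfies $s_0=s_k=3$ and $\sum_{i=1}^k|s_i-s_{i-1}|=4$. This forces $k\in\{2,3,4\}$. The gap lengths are $\ell_i=x_{i+1}-x_i>0$, $1\le i\le k-1$. Moduli space.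 For each such slope sequence $\tau$ with $k$ break points put $C_\tau^\circ=\mathbb{R}_{>0}^{k-1}$ (gap lengths); maps with slope sequence $\tau$, up to post-composition by $\mathrm{Aut}(\mathbb{T}\mathbb{P}^1)$, are parametrized by $C_\tau^\circ\times\mathbb{R}$, the factor $\mathbb{R}$ being translation of the source. $\mathcal{M}_3^{\mathrm{trop}}$ is the union of these cells, parametrizing degree-$3$ tropical rational maps up to post-composition, where a cell is glued along the face $\ell_i=0$ of $\mathbb{R}_{\ge0}^{k-1}\times\mathbb{R}$ to the cell of the slope sequence obtained by merging the jumps $\delta_i=s_i-s_{i-1}$ and $\delta_{i+1}=s_{i+1}-s_i$ into the single jump $\delta_i+\delta_{i+1}$, whenever $\delta_i,\delta_{i+1}$ have the same sign (faces with opposite signs are not included). There is no quotient by reparametrizations of the source. The maximal cones are those with $k=4$. The automorphism group of $\varphi$ is $$\mathrm{Aut}(\varphi)=\{(\alpha,\beta)\in\mathrm{Aut}(\mathbb{T}\mathbb{P}^1)\times\mathrm{Aut}(\mathbb{T}\mathbb{P}^1) : \beta\circ\varphi=\varphi\circ\alpha\}.$$ *)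

theory Defs
  imports "HOL-Analysis.Analysis" "HOL-Algebra.Elementary_Groups"
begin

section \<open>The tropical projective line\<close>

text \<open>
  The tropical projective line is the type \<^typ>\<open>ereal\<close>, with its order topology.
  Its automorphisms form a group under composition.
\<close>

definition TP1_aut :: "(ereal \<Rightarrow> ereal) monoid" where
  "TP1_aut = \<lparr>carrier = {\<alpha>. \<exists>\<epsilon>\<in>{1, -1::real}. \<exists>b::real. \<alpha> = (\<lambda>x. ereal \<epsilon> * x + ereal b)},
              monoid.mult = (\<circ>), one = id\<rparr>"

definition map_aut :: "(ereal \<Rightarrow> ereal) \<Rightarrow> ((ereal \<Rightarrow> ereal) \<times> (ereal \<Rightarrow> ereal)) monoid" where
  "map_aut \<phi> = (TP1_aut \<times>\<times> TP1_aut)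
     \<lparr>carrier := {(\<alpha>, \<beta>) \<in> carrier (TP1_aut \<times>\<times> TP1_aut). \<beta> \<circ> \<phi> = \<phi> \<circ> \<alpha>}\<rparr>"


section \<open>Tropical rational maps of degree 3\<close>

text \<open>
  A slope sequence \<open>(s\<^sub>0, \<dots>, s\<^sub>k)\<close> is a list of integers of length \<open>k + 1\<close>. Break points and
  gap lengths are functions on \<^typ>\<open>nat\<close>, of which the arguments \<open>1, \<dots>, k\<close>, respectively
  \<open>1, \<dots>, k - 1\<close>, are relevant.
\<close>

definition nbreaks :: "int list \<Rightarrow> nat" where
  "nbreaks \<tau> = length \<tau> - 1"

definition jump :: "int list \<Rightarrow> nat \<Rightarrow> int" where
  "jump \<tau> i = \<tau> ! i - \<tau> ! (i - 1)"

definition slope_types :: "int list set" where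
  "slope_types = {\<tau>. \<tau> \<noteq> [] \<and> hd \<tau> = 3 \<and> last \<tau> = 3 \<and>
     (\<forall>i\<in>{1..nbreaks \<tau>}. jump \<tau> i \<noteq> 0) \<and> (\<Sum>i=1..nbreaks \<tau>. \<bar>jump \<tau> i\<bar>) = 4}"

text \<open>The interval \<open>(x\<^sub>i, x\<^sub>i\<^sub>+\<^sub>1)\<close>, where \<open>x\<^sub>0 = -\<infinity>\<close> and \<open>x\<^sub>k\<^sub>+\<^sub>1 = \<infinity>\<close>.\<close>

definition segment :: "nat \<Rightarrow> (nat \<Rightarrow> real) \<Rightarrow> nat \<Rightarrow> real set" where
  "segment k x i = {u. (1 \<le> i \<longrightarrow> x i < u) \<and> (i < k \<longrightarrow> u < x (Suc i))}"

text \<open>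
  Continuity of \<open>\<phi>\<close> on all of \<^typ>\<open>ereal\<close> expresses both that the real function \<open>f\<close> is continuous
  and that \<open>\<phi>\<close> is its extension to the points at infinity.
\<close>

definition has_slopes_and_breaks ::
    "int list \<Rightarrow> (nat \<Rightarrow> real) \<Rightarrow> (ereal \<Rightarrow> ereal) \<Rightarrow> bool" where
  "has_slopes_and_breaks \<tau> x \<phi> \<longleftrightarrow>
     strict_mono_on {1..nbreaks \<tau>} x \<and> continuous_on UNIV \<phi> \<and>
     (\<exists>f :: real \<Rightarrow> real. (\<forall>u. \<phi> (ereal u) = ereal (f u)) \<and>
        (\<forall>i\<le>nbreaks \<tau>. \<forall>u\<in>segment (nbreaks \<tau>) x i. \<forall>v\<in>segment (nbreaks \<tau>) x i.
           f v - f u = of_int (\<tau> ! i) * (v - u)))"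

definition deg3_maps :: "(ereal \<Rightarrow> ereal) set" where
  "deg3_maps = {\<phi>. \<exists>\<tau>\<in>slope_types. \<exists>x. has_slopes_and_breaks \<tau> x \<phi>}"

definition postcomp_rel :: "((ereal \<Rightarrow> ereal) \<times> (ereal \<Rightarrow> ereal)) set" where
  "postcomp_rel = {(\<phi>, \<psi>). \<phi> \<in> deg3_maps \<and> \<psi> \<in> deg3_maps \<and> (\<exists>\<beta>\<in>carrier TP1_aut. \<psi> = \<beta> \<circ> \<phi>)}"


section \<open>Cells and gluing\<close>

text \<open>
  A point of a cell is a pair \<open>(l, t)\<close> of the gap lengths and the first break point \<open>t = x\<^sub>1\<close>,
  which serves as the coordinate for translations of the source. Irrelevant entries
  of \<open>l\<close> are \<open>0\<close>, so that the cell of a type with \<open>k\<close> break points sits inside a copy of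
  \<open>\<real>\<^sup>k\<^sup>-\<^sup>1 \<times> \<real>\<close> in the product topology.
\<close>

type_synonym cell_point = "(nat \<Rightarrow> real) \<times> real"

definition open_cell :: "int list \<Rightarrow> cell_point set" where
  "open_cell \<tau> = {(l, t). (\<forall>i\<in>{1..<nbreaks \<tau>}. l i > 0) \<and> (\<forall>i. i \<notin> {1..<nbreaks \<tau>} \<longrightarrow> l i = 0)}"

text \<open>The cell together with those of its faces along which it is glued.\<close>

definition partial_closed_cell :: "int list \<Rightarrow> cell_point set" where
  "partial_closed_cell \<tau> = {(l, t).
     (\<forall>i\<in>{1..<nbreaks \<tau>}. l i \<ge> 0 \<and> (l i = 0 \<longrightarrow> jump \<tau> i * jump \<tau> (Suc i) > 0)) \<and>
     (\<forall>i. i \<notin> {1..<nbreaks \<tau>} \<longrightarrow> l i = 0)}"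

definition break_point :: "cell_point \<Rightarrow> nat \<Rightarrow> real" where
  "break_point p i = snd p + (\<Sum>j=1..<i. fst p j)"

text \<open>
  Merging the jumps \<open>i\<close> and \<open>i + 1\<close> amounts to deleting the slope \<open>s\<^sub>i\<close>; the vanishing
  gap length \<open>l i\<close> disappears and the later ones move down by one index.
\<close>

inductive glue :: "int list \<times> cell_point \<Rightarrow> int list \<times> cell_point \<Rightarrow> bool" where
  "1 \<le> i \<Longrightarrow> i < nbreaks \<tau> \<Longrightarrow> l i = 0 \<Longrightarrow> jump \<tau> i * jump \<tau> (Suc i) > 0 \<Longrightarrow>
   glue (\<tau>, l, t) (take i \<tau> @ drop (Suc i) \<tau>, (\<lambda>j. if j < i then l j else l (Suc j)), t)"

text \<open>
  The point of the moduli space given by a point of a partially closed cell: the class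
  of the maps having the slopes, gaps and first break point of the open cell point
  reached by the gluing (which is the given point itself if all gaps are positive).
\<close>

definition moduli_point :: "int list \<times> cell_point \<Rightarrow> (ereal \<Rightarrow> ereal) set" where
  "moduli_point q = {\<phi>. \<exists>\<tau> p. glue\<^sup>*\<^sup>* q (\<tau>, p) \<and> p \<in> open_cell \<tau> \<and>
                            has_slopes_and_breaks \<tau> (break_point p) \<phi>}"

definition cells_topology :: "(int list \<times> cell_point) topology" where
  "cells_topology = sum_topology (\<lambda>\<tau>. top_of_set (partial_closed_cell \<tau>)) slope_types"

text \<open>
  The moduli space of maps up to post-composition, with the quotient topology of the
  disjoint union of the partially closed cells.
\<close>

definition moduli_space :: "(ereal \<Rightarrow> ereal) set topology" where
  "moduli_space = topology (\<lambda>U. U \<subseteq> deg3_maps // postcomp_rel \<and>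
     openin cells_topology {q \<in> topspace cells_topology. moduli_point q \<in> U})"

lemma openin_moduli_space:
  "openin moduli_space U \<longleftrightarrow> U \<subseteq> deg3_maps // postcomp_rel \<and>
     openin cells_topology {q \<in> topspace cells_topology. moduli_point q \<in> U}"
proof -
  have "istopology (\<lambda>U. U \<subseteq> deg3_maps // postcomp_rel \<and>
     openin cells_topology {q \<in> topspace cells_topology. moduli_point q \<in> U})"
    unfolding istopology_def
  proof (intro conjI allI impI; (elim conjE)?)
    fix S T
    assume "openin cells_topology {q \<in> topspace cells_topology. moduli_point q \<in> S}"
      and "openin cells_topology {q \<in> topspace cells_topology. moduli_point q \<in> T}"
    then have "openin cells_topology ({q \<in> topspace cells_topology. moduli_point q \<in> S}
                 \<inter> {q \<in> topspace cells_topology. moduli_point q \<in> T})"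
      by (rule openin_Int)
    also have "\<dots> = {q \<in> topspace cells_topology. moduli_point q \<in> S \<inter> T}"
      by blast
    finally show "openin cells_topology {q \<in> topspace cells_topology. moduli_point q \<in> S \<inter> T}" .
  next
    fix \<K>
    assume *: "\<forall>K\<in>\<K>. K \<subseteq> deg3_maps // postcomp_rel \<and>
      openin cells_topology {q \<in> topspace cells_topology. moduli_point q \<in> K}"
    then have "openin cells_topology (\<Union>K\<in>\<K>. {q \<in> topspace cells_topology. moduli_point q \<in> K})"
      by blast
    also have "(\<Union>K\<in>\<K>. {q \<in> topspace cells_topology. moduli_point q \<in> K})
                 = {q \<in> topspace cells_topology. moduli_point q \<in> \<Union>\<K>}"
      by blast
    finally show "openin cells_topology {q \<in> topspace cells_topology. moduli_point q \<in> \<Union>\<K>}" .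
  qed blast+
  then show ?thesis
    by (simp add: moduli_space_def)
qed

text \<open>
  Since \<open>k \<le> 4\<close>, all gap lengths are recorded by the first three entries. Dimensions of
  subsets of the moduli space are those of polyhedral geometry: the maximum, over all
  cells, of the dimension of the affine span of the part lying in the cell.
\<close>

definition cell_coords :: "cell_point \<Rightarrow> (real^3) \<times> real" where
  "cell_coords p = (vector [fst p 1, fst p 2, fst p 3], snd p)"

definition cell_dim :: "cell_point set \<Rightarrow> int" where
  "cell_dim A = aff_dim (cell_coords ` A)"

definition stratum_dim :: "(ereal \<Rightarrow> ereal) set set \<Rightarrow> int" where
  "stratum_dim S = (MAX \<tau>\<in>slope_types. cell_dim {p \<in> open_cell \<tau>. moduli_point (\<tau>, p) \<in> S})"


section \<open>Stratifications and the strata\<close>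

text \<open>
  A finite partition into nonempty locally closed sets satisfying the frontier condition.
\<close>

definition stratification :: "'a topology \<Rightarrow> 'a set set \<Rightarrow> bool" where
  "stratification X \<S> \<longleftrightarrow>
     finite \<S> \<and> {} \<notin> \<S> \<and> disjoint \<S> \<and> \<Union>\<S> = topspace X \<and>
     (\<forall>S\<in>\<S>. \<exists>U C. openin X U \<and> closedin X C \<and> S = U \<inter> C) \<and>
     (\<forall>S\<in>\<S>. \<forall>T\<in>\<S>. S \<inter> X closure_of T \<noteq> {} \<longrightarrow> S \<subseteq> X closure_of T)"

definition generic_stratum :: "(ereal \<Rightarrow> ereal) set set" where
  "generic_stratum = {c \<in> deg3_maps // postcomp_rel. \<forall>\<phi>\<in>c. trivial_group (map_aut \<phi>)}"

definition symmetric_stratum :: "(ereal \<Rightarrow> ereal) set set" where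
  "symmetric_stratum = {moduli_point (\<tau>, l, t) |\<tau> l t.
     \<tau> \<in> slope_types \<and> nbreaks \<tau> = 4 \<and> rev \<tau> = \<tau> \<and> (l, t) \<in> open_cell \<tau> \<and> l 1 = l 3}"

definition symmetric_boundary :: "(ereal \<Rightarrow> ereal) set set" where
  "symmetric_boundary = {moduli_point (\<tau>, p) |\<tau> p. \<tau> \<in> {[3,5,3], [3,1,3]} \<and> p \<in> open_cell \<tau>}"

end

theory Submission
  imports Defs
begin

text \<open>
  A map of degree 3 is, up to an additive constant, the sum of \<open>3 * u\<close> and of ramps
  \<open>\<delta>\<^sub>i * max 0 (u - x\<^sub>i)\<close>, where \<open>\<delta>\<^sub>i\<close> are the jumps of the slope (\<open>has_slopes_and_breaks_iff\<close>).
  The second differences of this broken line recover breaks and jumps (\<open>broken_line_unique\<close>),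
  whereas merging jumps at a common break does not change it (\<open>glue_cells\<close>). So a point of the
  moduli space is the same as a broken line modulo constants, every point lies in exactly one
  open cell, and on a closed cell the broken line varies continuously up to the glued faces.

  An automorphism \<open>(\<alpha>, \<beta>)\<close> of such a map has equal signs in \<open>\<alpha>\<close> and \<open>\<beta>\<close>, since the map fixes
  both points at infinity. A nonzero translation cannot preserve the finite nonempty set of
  breaks, so the only possible nontrivial automorphism is a single reflection
  \<open>f (b - u) = c - f u\<close>, and the group is trivial or of order two (\<open>map_aut_dichotomy\<close>). The
  reflected broken line has the reversed slope sequence and the mirrored breaks; by uniqueness
  the reflection is an automorphism exactly if the slope sequence is palindromic and the
  breaks are symmetric about their centre (\<open>reflection_iff_symmetric_breaks\<close>). Palindromic
  sequences have two breaks, where the breaks are always symmetric, or four, where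
  symmetry is the equality \<open>\<ell>\<^sub>1 = \<ell>\<^sub>3\<close> of the outer gaps (\<open>odd_symmetric_open_cell\<close>).

  The centre of a reflection is the midpoint of the extreme breaks. These are continuous on the
  closed cells and compatible with gluing, so that symmetry is a closed condition; having only
  two breaks is closed for a similar reason (\<open>closedin_symmetric_strata\<close>,
  \<open>closedin_symmetric_boundary\<close>). Conversely, a symmetric map is a limit of
  asymmetric ones, and one with two breaks is a limit of symmetric ones with four, obtained
  by splitting its double jumps. This gives the frontier condition (\<open>stratification_symmetry\<close>).
  The dimensions are read off from the linear equations that cut out the strata in the cells.
\<close>


section \<open>Slope sequences\<close>

lemma slope_eq_sum_jumps:
  assumes "\<tau> \<noteq> []" "i \<le> nbreaks \<tau>"
  shows "\<tau> ! i = hd \<tau> + (\<Sum>j=1..i. jump \<tau> j)"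
  using assms(2)
proof (induction i)
  case 0
  then show ?case using assms(1) by (simp add: hd_conv_nth)
next
  case (Suc i)
  then show ?case by (simp add: jump_def)
qed

text \<open>
  Each jump has absolute value at least 1, so there are at most four; as the jumps cancel,
  there are at least two.
\<close>

lemma slope_typesD:
  assumes "\<tau> \<in> slope_types"
  shows "\<tau> \<noteq> []" "length \<tau> = Suc (nbreaks \<tau>)" "\<tau> ! 0 = 3" "\<tau> ! nbreaks \<tau> = 3"
    "\<And>i. i \<in> {1..nbreaks \<tau>} \<Longrightarrow> jump \<tau> i \<noteq> 0"
    "(\<Sum>i=1..nbreaks \<tau>. \<bar>jump \<tau> i\<bar>) = 4" "(\<Sum>i=1..nbreaks \<tau>. jump \<tau> i) = 0"
    "\<And>i. i \<le> nbreaks \<tau> \<Longrightarrow> \<tau> ! i = 3 + (\<Sum>j=1..i. jump \<tau> j)"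
    "2 \<le> nbreaks \<tau>" "nbreaks \<tau> \<le> 4"
proof -
  show ne: "\<tau> \<noteq> []" using assms by (simp add: slope_types_def)
  then show "length \<tau> = Suc (nbreaks \<tau>)" by (simp add: nbreaks_def)
  show "\<tau> ! 0 = 3" using assms ne by (simp add: slope_types_def flip: hd_conv_nth)
  show last: "\<tau> ! nbreaks \<tau> = 3"
    using assms last_conv_nth[OF ne] by (simp add: slope_types_def nbreaks_def)
  show nz: "jump \<tau> i \<noteq> 0" if "i \<in> {1..nbreaks \<tau>}" for i
    using assms that by (simp add: slope_types_def)
  show abs: "(\<Sum>i=1..nbreaks \<tau>. \<bar>jump \<tau> i\<bar>) = 4" using assms by (simp add: slope_types_def)
  show slope: "\<tau> ! i = 3 + (\<Sum>j=1..i. jump \<tau> j)" if "i \<le> nbreaks \<tau>" for i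
    using assms slope_eq_sum_jumps[OF ne that] by (simp add: slope_types_def)
  show sum: "(\<Sum>i=1..nbreaks \<tau>. jump \<tau> i) = 0"
    using slope[of "nbreaks \<tau>"] last by simp
  show "nbreaks \<tau> \<le> 4"
  proof -
    have "int (nbreaks \<tau>) = (\<Sum>i=1..nbreaks \<tau>. 1)" by simp
    also have "\<dots> \<le> (\<Sum>i=1..nbreaks \<tau>. \<bar>jump \<tau> i\<bar>)"
      by (rule sum_mono) (use nz in \<open>force\<close>)
    finally show ?thesis using abs by simp
  qed
  have "nbreaks \<tau> \<noteq> 0"
  proof
    assume "nbreaks \<tau> = 0"
    then show False using abs by simp
  qed
  moreover have "nbreaks \<tau> \<noteq> 1"
  proof
    assume "nbreaks \<tau> = 1"
    then show False using abs sum by simp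
  qed
  ultimately show "2 \<le> nbreaks \<tau>" by linarith
qed

lemma finite_slope_types: "finite slope_types"
proof (rule finite_subset)
  show "slope_types \<subseteq> {\<tau>. set \<tau> \<subseteq> {-1..7} \<and> length \<tau> \<le> 5}"
  proof
    fix \<tau> assume \<tau>: "\<tau> \<in> slope_types"
    have "\<tau> ! i \<in> {-1..7}" if "i < length \<tau>" for i
    proof -
      have i: "i \<le> nbreaks \<tau>" using that slope_typesD(2)[OF \<tau>] by simp
      have "\<bar>\<Sum>j=1..i. jump \<tau> j\<bar> \<le> (\<Sum>j=1..i. \<bar>jump \<tau> j\<bar>)" by (rule sum_abs)
      also have "\<dots> \<le> (\<Sum>j=1..nbreaks \<tau>. \<bar>jump \<tau> j\<bar>)"
        by (rule sum_mono2) (use i in auto)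
      finally show ?thesis using slope_typesD(6)[OF \<tau>] slope_typesD(8)[OF \<tau> i] by auto
    qed
    then show "\<tau> \<in> {\<tau>. set \<tau> \<subseteq> {-1..7} \<and> length \<tau> \<le> 5}"
      using slope_typesD(2,10)[OF \<tau>] by (auto simp: in_set_conv_nth)
  qed
  show "finite {\<tau>. set \<tau> \<subseteq> {-1..7::int} \<and> length \<tau> \<le> 5}"
    by (rule finite_lists_length_le) simp
qed

lemma slope_types_eqI:
  assumes "\<tau> \<in> slope_types" "\<tau>' \<in> slope_types" "nbreaks \<tau> = nbreaks \<tau>'"
    "\<And>i. i \<in> {1..nbreaks \<tau>} \<Longrightarrow> jump \<tau> i = jump \<tau>' i"
  shows "\<tau> = \<tau>'"
proof (rule nth_equalityI)
  show "length \<tau> = length \<tau>'" using assms(3) slope_typesD(2)[OF assms(1)] slope_typesD(2)[OF assms(2)] by simp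
  fix i assume "i < length \<tau>"
  then have i: "i \<le> nbreaks \<tau>" using slope_typesD(2)[OF assms(1)] by simp
  have "(\<Sum>j=1..i. jump \<tau> j) = (\<Sum>j=1..i. jump \<tau>' j)"
    by (rule sum.cong) (use i assms(4) in auto)
  then show "\<tau> ! i = \<tau>' ! i"
    using slope_typesD(8)[OF assms(1)] slope_typesD(8)[OF assms(2)] i assms(3) by simp
qed

lemma jump_rev:
  assumes "i \<in> {1..nbreaks \<tau>}"
  shows "jump (rev \<tau>) i = - jump \<tau> (Suc (nbreaks \<tau>) - i)"
proof -
  have len: "length \<tau> = Suc (nbreaks \<tau>)" using assms by (auto simp: nbreaks_def)
  have "rev \<tau> ! i = \<tau> ! (nbreaks \<tau> - i)" "rev \<tau> ! (i - 1) = \<tau> ! (Suc (nbreaks \<tau>) - i)"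
    using assms len by (auto simp: rev_nth Suc_diff_le)
  then show ?thesis using assms by (simp add: jump_def)
qed

lemma nbreaks_rev [simp]: "nbreaks (rev \<tau>) = nbreaks \<tau>"
  by (simp add: nbreaks_def)

lemma sum_reindex_reflect:
  "(\<Sum>i=1..n. g (Suc n - i)) = (\<Sum>i=1..n. g i)" for g :: "nat \<Rightarrow> 'a::comm_monoid_add"
  by (rule sum.reindex_bij_witness[of _ "\<lambda>i. Suc n - i" "\<lambda>i. Suc n - i"]) auto

lemma rev_slope_types:
  assumes "\<tau> \<in> slope_types"
  shows "rev \<tau> \<in> slope_types"
proof -
  let ?k = "nbreaks \<tau>"
  have "(\<Sum>i=1..?k. \<bar>jump (rev \<tau>) i\<bar>) = (\<Sum>i=1..?k. \<bar>jump \<tau> (Suc ?k - i)\<bar>)"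
    by (rule sum.cong) (simp_all add: jump_rev)
  also have "\<dots> = 4"
    using slope_typesD(6)[OF assms] by (simp only: sum_reindex_reflect[of "\<lambda>i. \<bar>jump \<tau> i\<bar>"])
  finally have "(\<Sum>i=1..?k. \<bar>jump (rev \<tau>) i\<bar>) = 4" .
  moreover have "jump (rev \<tau>) i \<noteq> 0" if "i \<in> {1..?k}" for i
  proof -
    have "Suc ?k - i \<in> {1..?k}" using that by auto
    then show ?thesis using slope_typesD(5)[OF assms] jump_rev[OF that] by simp
  qed
  ultimately show ?thesis
    using assms by (auto simp: slope_types_def hd_rev last_rev)
qed

text \<open>
  Reversal negates the jump at the middle break point, so a palindromic sequence
  with three breaks would have a vanishing jump.
\<close>

lemma palindromic_nbreaks:
  assumes "\<tau> \<in> slope_types" "rev \<tau> = \<tau>"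
  shows "nbreaks \<tau> = 2 \<or> nbreaks \<tau> = 4"
proof -
  have "nbreaks \<tau> \<noteq> 3"
  proof
    assume "nbreaks \<tau> = 3"
    then show False
      using jump_rev[of 2 \<tau>] slope_typesD(5)[OF assms(1), of 2] assms(2) by simp
  qed
  then show ?thesis using slope_typesD(9,10)[OF assms(1)] by linarith
qed

lemma two_break_types: "{\<tau>\<in>slope_types. nbreaks \<tau> = 2} = {[3,5,3], [3,1,3]}"
proof (intro equalityI subsetI)
  fix \<tau> assume "\<tau> \<in> {\<tau>\<in>slope_types. nbreaks \<tau> = 2}"
  then have \<tau>: "\<tau> \<in> slope_types" and k: "nbreaks \<tau> = 2" by auto
  have "length \<tau> = Suc (Suc (Suc 0))" using slope_typesD(2)[OF \<tau>] k by simp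
  then obtain a b c where abc: "\<tau> = [a, b, c]" by (auto simp: length_Suc_conv)
  have "a = 3" "c = 3" using slope_typesD(3,4)[OF \<tau>] k abc by auto
  moreover have "\<bar>b - a\<bar> + \<bar>c - b\<bar> = 4"
    using slope_typesD(6)[OF \<tau>] k abc by (simp add: jump_def numeral_2_eq_2)
  ultimately have "b = 5 \<or> b = 1" by linarith
  then show "\<tau> \<in> {[3,5,3], [3,1,3]}" using abc \<open>a = 3\<close> \<open>c = 3\<close> by auto
qed (auto simp: slope_types_def nbreaks_def jump_def numeral_2_eq_2 atLeastAtMostSuc_conv)

lemma four_break_types:
  "[3,4,5,4,3] \<in> slope_types" "[3,2,1,2,3] \<in> slope_types" "[3,4,3,2,3] \<in> slope_types"
  by (auto simp: slope_types_def nbreaks_def jump_def eval_nat_numeral atLeastAtMostSuc_conv)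


section \<open>Broken lines and their kinks\<close>

text \<open>
  The piecewise linear function with initial slope 3 and jump \<open>jump \<tau> i\<close> at \<open>x i\<close>, as a sum of
  ramps. The formula makes sense for coinciding breaks as well, hence also on the faces of
  the cells, and it depends continuously on the breaks.
\<close>

definition broken_line :: "int list \<Rightarrow> (nat \<Rightarrow> real) \<Rightarrow> real \<Rightarrow> real" where
  "broken_line \<tau> x u = 3 * u + (\<Sum>i=1..nbreaks \<tau>. of_int (jump \<tau> i) * max 0 (u - x i))"

text \<open>
  The limit of the symmetric second differences divided by the step size: the jump of the
  slope at \<open>x\<close>.
\<close>

definition kink :: "(real \<Rightarrow> real) \<Rightarrow> real \<Rightarrow> real" where
  "kink f x = Lim (at_right 0) (\<lambda>h. (f (x + h) + f (x - h) - 2 * f x) / h)"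

lemma kink_add_const: "kink (\<lambda>u. f u + c) = kink f"
proof
  fix x
  have "(f (x + h) + c + (f (x - h) + c) - 2 * (f x + c)) = f (x + h) + f (x - h) - 2 * f x" for h
    by simp
  then show "kink (\<lambda>u. f u + c) x = kink f x" by (simp only: kink_def)
qed

lemma kink_broken_line:
  "kink (broken_line \<tau> x) y = of_int (\<Sum>i | i \<in> {1..nbreaks \<tau>} \<and> x i = y. jump \<tau> i)"
proof -
  let ?I = "{1..nbreaks \<tau>}"
  have ramp: "\<forall>\<^sub>F h in at_right 0. max 0 (y + h - x i) + max 0 (y - h - x i) - 2 * max 0 (y - x i)
                = (if x i = y then h else 0)" for i
  proof (cases "x i = y")
    case True
    have "\<forall>\<^sub>F h in at_right (0::real). 0 < h" by (simp add: eventually_at_right_less)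
    then show ?thesis by (rule eventually_mono) (use True in \<open>auto simp: max_def\<close>)
  next
    case False
    then have "\<forall>\<^sub>F h in at_right 0. 0 < h \<and> h < \<bar>y - x i\<bar>"
      by (auto simp: eventually_at_right_field intro!: exI[of _ "\<bar>y - x i\<bar>"])
    then show ?thesis by (rule eventually_mono) (use False in \<open>auto simp: max_def\<close>)
  qed
  have "\<forall>\<^sub>F h in at_right 0. \<forall>i\<in>?I.
      max 0 (y + h - x i) + max 0 (y - h - x i) - 2 * max 0 (y - x i) = (if x i = y then h else 0)"
    using ramp by (intro eventually_ball_finite) auto
  moreover have "\<forall>\<^sub>F h in at_right (0::real). 0 < h" by (simp add: eventually_at_right_less)
  ultimately have ev: "\<forall>\<^sub>F h in at_right 0.
      (broken_line \<tau> x (y + h) + broken_line \<tau> x (y - h) - 2 * broken_line \<tau> x y) / h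
        = of_int (\<Sum>i | i \<in> ?I \<and> x i = y. jump \<tau> i)"
  proof eventually_elim
    case (elim h)
    have "broken_line \<tau> x (y + h) + broken_line \<tau> x (y - h) - 2 * broken_line \<tau> x y
       = (\<Sum>i\<in>?I. of_int (jump \<tau> i) *
            (max 0 (y + h - x i) + max 0 (y - h - x i) - 2 * max 0 (y - x i)))"
      unfolding broken_line_def
      by (simp add: algebra_simps sum.distrib sum_subtractf sum_distrib_left)
    also have "\<dots> = (\<Sum>i\<in>?I. of_int (jump \<tau> i) * (if x i = y then h else 0))"
      by (rule sum.cong) (use elim in auto)
    also have "\<dots> = (\<Sum>i\<in>?I. if x i = y then of_int (jump \<tau> i) * h else 0)"
      by (rule sum.cong) auto
    also have "\<dots> = (\<Sum>i | i \<in> ?I \<and> x i = y. of_int (jump \<tau> i) * h)"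
      by (simp only: sum.inter_filter[OF finite_atLeastAtMost])
    finally show ?case using elim(2) by (simp flip: sum_distrib_right)
  qed
  have "((\<lambda>h. (broken_line \<tau> x (y + h) + broken_line \<tau> x (y - h) - 2 * broken_line \<tau> x y) / h)
      \<longlongrightarrow> of_int (\<Sum>i | i \<in> ?I \<and> x i = y. jump \<tau> i)) (at_right 0)"
    by (rule tendsto_eventually) (rule ev)
  then show ?thesis unfolding kink_def by (rule tendsto_Lim[rotated]) simp
qed

lemma kink_at_break:
  assumes "strict_mono_on {1..nbreaks \<tau>} x" "i \<in> {1..nbreaks \<tau>}"
  shows "kink (broken_line \<tau> x) (x i) = of_int (jump \<tau> i)"
proof -
  have "{j. j \<in> {1..nbreaks \<tau>} \<and> x j = x i} = {i}"
    using assms strict_mono_on_imp_inj_on[OF assms(1)] by (auto dest: inj_onD)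
  then show ?thesis by (simp add: kink_broken_line)
qed

lemma kink_support:
  assumes "strict_mono_on {1..nbreaks \<tau>} x" "\<tau> \<in> slope_types"
  shows "{y. kink (broken_line \<tau> x) y \<noteq> 0} = x ` {1..nbreaks \<tau>}"
proof (intro equalityI subsetI)
  fix y assume y: "y \<in> {y. kink (broken_line \<tau> x) y \<noteq> 0}"
  have "{i. i \<in> {1..nbreaks \<tau>} \<and> x i = y} \<noteq> {}"
  proof
    assume "{i. i \<in> {1..nbreaks \<tau>} \<and> x i = y} = {}"
    then have "kink (broken_line \<tau> x) y = 0" unfolding kink_broken_line by (simp only: sum.empty of_int_0)
    then show False using y by simp
  qed
  then show "y \<in> x ` {1..nbreaks \<tau>}" by auto
qed (use kink_at_break[OF assms(1)] slope_typesD(5)[OF assms(2)] in auto)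

text \<open>
  A finite set has only one increasing enumeration.
\<close>

lemma strict_mono_on_same_image:
  fixes x y :: "nat \<Rightarrow> 'a::linorder"
  assumes "strict_mono_on {1..m} x" "strict_mono_on {1..n} y" "x ` {1..m} = y ` {1..n}"
  shows "m = n" "i \<in> {1..m} \<Longrightarrow> x i = y i"
proof -
  have "card (x ` {1..m}) = m" "card (y ` {1..n}) = n"
    using assms(1,2) by (simp_all add: card_image strict_mono_on_imp_inj_on)
  then show mn: "m = n" using assms(3) by simp
  have sorted: "sorted (map z [1..<Suc k])" "distinct (map z [1..<Suc k])"
    if "strict_mono_on {1..k} z" for z :: "nat \<Rightarrow> 'a" and k
  proof -
    have "sorted_wrt (<) (map z [1..<Suc k])"
      using that
      by (auto simp: sorted_wrt_map strict_mono_on_def simp del: upt_Suc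
            intro: sorted_wrt_mono_rel[OF _ sorted_wrt_upt])
    then show "sorted (map z [1..<Suc k])" "distinct (map z [1..<Suc k])"
      by (simp_all add: strict_sorted_iff)
  qed
  have "map x [1..<Suc m] = map y [1..<Suc n]"
    by (rule sorted_distinct_set_unique)
      (use sorted assms in \<open>auto simp: atLeastLessThanSuc_atLeastAtMost simp del: upt_Suc\<close>)
  then show "x i = y i" if "i \<in> {1..m}"
    using that mn by (auto simp: map_eq_conv simp del: upt_Suc)
qed

text \<open>
  The kinks of a broken line do not see additive constants, their support is the set
  of break points and their values are the jumps. All coordinates of an open cell can thus
  be read off from the function.
\<close>

lemma broken_line_unique:
  assumes \<tau>: "\<tau> \<in> slope_types" "strict_mono_on {1..nbreaks \<tau>} x"
    and \<tau>': "\<tau>' \<in> slope_types" "strict_mono_on {1..nbreaks \<tau>'} x'"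
    and eq: "\<And>u. broken_line \<tau>' x' u = broken_line \<tau> x u + c"
  shows "\<tau> = \<tau>'" "i \<in> {1..nbreaks \<tau>} \<Longrightarrow> x i = x' i"
proof -
  have kink: "kink (broken_line \<tau>' x') = kink (broken_line \<tau> x)"
    unfolding eq[abs_def] by (rule kink_add_const)
  have im: "x ` {1..nbreaks \<tau>} = x' ` {1..nbreaks \<tau>'}"
    using kink_support[of \<tau> x] kink_support[of \<tau>' x'] \<tau> \<tau>' kink by simp
  note same = strict_mono_on_same_image[OF \<tau>(2) \<tau>'(2) im]
  show "x i = x' i" if "i \<in> {1..nbreaks \<tau>}" for i by (rule same(2)[OF that])
  show "\<tau> = \<tau>'"
  proof (rule slope_types_eqI[OF \<tau>(1) \<tau>'(1) same(1)])
    fix i assume i: "i \<in> {1..nbreaks \<tau>}"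
    have "real_of_int (jump \<tau> i) = kink (broken_line \<tau> x) (x i)"
      using kink_at_break[OF \<tau>(2) i] by simp
    also have "\<dots> = real_of_int (jump \<tau>' i)"
      using kink_at_break[OF \<tau>'(2), of i] same i kink by simp
    finally show "jump \<tau> i = jump \<tau>' i" by simp
  qed
qed

text \<open>
  The point reflection \<open>u \<mapsto> c - f (b - u)\<close> of a broken line is again a broken line, with reversed
  slopes and mirrored breaks. Together with uniqueness this reduces symmetry of the function
  to symmetry of its combinatorial data.
\<close>

lemma broken_line_reflect:
  assumes \<tau>: "\<tau> \<in> slope_types"
  shows "broken_line (rev \<tau>) (\<lambda>i. b - x (Suc (nbreaks \<tau>) - i)) u
    = 3 * b - (\<Sum>i=1..nbreaks \<tau>. of_int (jump \<tau> i) * x i) - broken_line \<tau> x (b - u)"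
proof -
  let ?k = "nbreaks \<tau>"
  define g where "g i = - real_of_int (jump \<tau> i) * max 0 (u - (b - x i))" for i
  have "(\<Sum>i=1..?k. of_int (jump (rev \<tau>) i) * max 0 (u - (b - x (Suc ?k - i))))
      = (\<Sum>i=1..?k. g (Suc ?k - i))"
    by (rule sum.cong) (simp_all add: jump_rev g_def)
  also have "\<dots> = (\<Sum>i=1..?k. g i)" by (rule sum_reindex_reflect)
  also have "\<dots> = (\<Sum>i=1..?k. of_int (jump \<tau> i) * (b - u - x i) - of_int (jump \<tau> i) * max 0 (b - u - x i))"
    by (rule sum.cong) (auto simp: g_def max_def algebra_simps)
  also have "\<dots> = (b - u) * of_int (\<Sum>i=1..?k. jump \<tau> i) - (\<Sum>i=1..?k. of_int (jump \<tau> i) * x i)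
      - (\<Sum>i=1..?k. of_int (jump \<tau> i) * max 0 (b - u - x i))"
    by (simp add: algebra_simps sum_subtractf sum_distrib_left sum.distrib)
  finally show ?thesis
    unfolding broken_line_def nbreaks_rev slope_typesD(7)[OF \<tau>] by simp
qed

text \<open>
  Symmetry of the graph under a point reflection; this is what an automorphism that
  reverses the source amounts to.
\<close>

definition odd_symmetric :: "(real \<Rightarrow> real) \<Rightarrow> bool" where
  "odd_symmetric f \<longleftrightarrow> (\<exists>b c. \<forall>u. f (b - u) = c - f u)"

text \<open>
  A translation symmetry would move the first break point.
\<close>

lemma broken_line_translation:
  assumes \<tau>: "\<tau> \<in> slope_types" "strict_mono_on {1..nbreaks \<tau>} x"
    and eq: "\<And>u. broken_line \<tau> x (u + b) = broken_line \<tau> x u + c"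
  shows "b = 0" "c = 0"
proof -
  have "broken_line \<tau> (\<lambda>i. x i - b) u = broken_line \<tau> x u + (c - 3 * b)" for u
    using eq[of u] by (simp add: broken_line_def algebra_simps)
  then have "x 1 = x 1 - b"
    using slope_typesD(9)[OF \<tau>(1)] \<tau>(2)
    by (intro broken_line_unique(2)[OF \<tau> \<tau>(1)]) (auto simp: strict_mono_on_def)
  then show "b = 0" by simp
  then show "c = 0" using eq[of 0] by simp
qed

text \<open>
  The reflected broken line has the data \<open>rev \<tau>\<close> and \<open>b - x (k + 1 - i)\<close>, so it agrees with the
  original one up to a constant exactly if these data are \<open>\<tau>\<close> and \<open>x\<close>.
\<close>

lemma reflection_iff_symmetric_breaks:
  assumes \<tau>: "\<tau> \<in> slope_types" "strict_mono_on {1..nbreaks \<tau>} x"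
  shows "(\<exists>c. \<forall>u. broken_line \<tau> x (b - u) = c - broken_line \<tau> x u) \<longleftrightarrow>
    rev \<tau> = \<tau> \<and> (\<forall>i\<in>{1..nbreaks \<tau>}. x i = b - x (Suc (nbreaks \<tau>) - i))"
    (is "?sym \<longleftrightarrow> ?breaks")
proof
  let ?x = "\<lambda>i. b - x (Suc (nbreaks \<tau>) - i)"
  have mono: "strict_mono_on {1..nbreaks (rev \<tau>)} ?x"
    by (rule strict_mono_onI) (auto intro!: strict_mono_onD[OF \<tau>(2)])
  {
    assume ?sym
    then obtain c where c: "\<And>u. broken_line \<tau> x (b - u) = c - broken_line \<tau> x u" by blast
    have "broken_line (rev \<tau>) ?x u = broken_line \<tau> x u
       + (3 * b - (\<Sum>i=1..nbreaks \<tau>. of_int (jump \<tau> i) * x i) - c)" for u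
      by (simp add: broken_line_reflect[OF \<tau>(1)] c)
    from broken_line_unique[OF \<tau> rev_slope_types[OF \<tau>(1)] mono this] show ?breaks by auto
  next
    assume b: ?breaks
    have "broken_line \<tau> x u = broken_line (rev \<tau>) ?x u" for u
      using b by (auto simp: broken_line_def intro!: sum.cong)
    then show ?sym
      unfolding broken_line_reflect[OF \<tau>(1)]
      by (intro exI[of _ "3 * b - (\<Sum>i=1..nbreaks \<tau>. of_int (jump \<tau> i) * x i)"]) (simp add: algebra_simps)
  }
qed


section \<open>Maps with prescribed slopes and break points\<close>

fun proj_extend :: "(real \<Rightarrow> real) \<Rightarrow> ereal \<Rightarrow> ereal" where
  "proj_extend f (ereal u) = ereal (f u)"
| "proj_extend f PInfty = PInfty"
| "proj_extend f MInfty = MInfty"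

lemma proj_extend_infinity [simp]: "proj_extend f \<infinity> = \<infinity>" "proj_extend f (-\<infinity>) = -\<infinity>"
  using proj_extend.simps(2,3)[of f] by simp_all

lemma proj_extend_eq_iff: "proj_extend f = proj_extend g \<longleftrightarrow> f = g"
  by (metis proj_extend.simps(1) ereal.inject ext)

text \<open>
  Since the jumps add up to 0, each ramp \<open>max 0 (u - x i)\<close> may be compared with \<open>max 0 u\<close>,
  from which it differs by at most \<open>\<bar>x i\<bar>\<close>.
\<close>

lemma broken_line_near_linear:
  assumes "\<tau> \<in> slope_types"
  shows "\<bar>broken_line \<tau> x u - 3 * u\<bar> \<le> (\<Sum>i=1..nbreaks \<tau>. \<bar>of_int (jump \<tau> i)\<bar> * \<bar>x i\<bar>)"
proof -
  have "broken_line \<tau> x u - 3 * u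
      = (\<Sum>i=1..nbreaks \<tau>. of_int (jump \<tau> i) * max 0 (u - x i)) - of_int (\<Sum>i=1..nbreaks \<tau>. jump \<tau> i) * max 0 u"
    unfolding slope_typesD(7)[OF assms] by (simp add: broken_line_def)
  also have "\<dots> = (\<Sum>i=1..nbreaks \<tau>. of_int (jump \<tau> i) * (max 0 (u - x i) - max 0 u))"
    by (simp add: sum_distrib_right sum_subtractf right_diff_distrib)
  also have "\<bar>\<dots>\<bar> \<le> (\<Sum>i=1..nbreaks \<tau>. \<bar>of_int (jump \<tau> i) * (max 0 (u - x i) - max 0 u)\<bar>)"
    by (rule sum_abs)
  also have "\<dots> \<le> (\<Sum>i=1..nbreaks \<tau>. \<bar>of_int (jump \<tau> i)\<bar> * \<bar>x i\<bar>)"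
    unfolding abs_mult by (intro sum_mono mult_left_mono) auto
  finally show ?thesis .
qed

lemma broken_line_limits:
  assumes "\<tau> \<in> slope_types"
  shows "filterlim (\<lambda>u. broken_line \<tau> x u + c) at_top at_top"
    "filterlim (\<lambda>u. broken_line \<tau> x u + c) at_bot at_bot"
proof -
  define C where "C = (\<Sum>i=1..nbreaks \<tau>. \<bar>real_of_int (jump \<tau> i)\<bar> * \<bar>x i\<bar>)"
  have bound: "\<bar>broken_line \<tau> x u - 3 * u\<bar> \<le> C" for u
    using broken_line_near_linear[OF assms] by (simp add: C_def)
  have "filterlim (\<lambda>u::real. 3 * u + (c - C)) at_top at_top"
    by real_asymp
  then show "filterlim (\<lambda>u. broken_line \<tau> x u + c) at_top at_top"
    by (rule filterlim_at_top_mono) (use bound in \<open>auto simp: abs_le_iff algebra_simps intro!: always_eventually\<close>)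
  have "filterlim (\<lambda>u::real. 3 * u + (c + C)) at_bot at_bot"
    by real_asymp
  then show "filterlim (\<lambda>u. broken_line \<tau> x u + c) at_bot at_bot"
    by (rule filterlim_at_bot_mono) (use bound in \<open>auto simp: abs_le_iff algebra_simps intro!: always_eventually\<close>)
qed

lemma continuous_broken_line: "continuous_on A (broken_line \<tau> x)"
  unfolding broken_line_def by (intro continuous_intros)

lemma broken_line_slope:
  assumes \<tau>: "\<tau> \<in> slope_types" "strict_mono_on {1..nbreaks \<tau>} x" and i: "i \<le> nbreaks \<tau>"
    and uv: "u \<in> segment (nbreaks \<tau>) x i" "v \<in> segment (nbreaks \<tau>) x i"
  shows "broken_line \<tau> x v - broken_line \<tau> x u = of_int (\<tau> ! i) * (v - u)"
proof -
  have ramp: "max 0 (w - x j) = (if j \<le> i then w - x j else 0)"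
    if "w \<in> segment (nbreaks \<tau>) x i" "j \<in> {1..nbreaks \<tau>}" for w j
  proof (cases "j \<le> i")
    case True
    then have "x j \<le> x i" using that i by (auto intro!: strict_mono_on_leD[OF \<tau>(2)])
    then show ?thesis using that True by (auto simp: segment_def)
  next
    case False
    then have "x (Suc i) \<le> x j" using that by (auto intro!: strict_mono_on_leD[OF \<tau>(2)])
    then show ?thesis using that False by (auto simp: segment_def)
  qed
  have "broken_line \<tau> x v - broken_line \<tau> x u = 3 * (v - u)
      + (\<Sum>j=1..nbreaks \<tau>. of_int (jump \<tau> j) * (max 0 (v - x j) - max 0 (u - x j)))"
    by (simp add: broken_line_def sum_subtractf right_diff_distrib)
  also have "(\<Sum>j=1..nbreaks \<tau>. of_int (jump \<tau> j) * (max 0 (v - x j) - max 0 (u - x j)))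
      = (\<Sum>j=1..nbreaks \<tau>. if j \<in> {1..i} then of_int (jump \<tau> j) * (v - u) else 0)"
    by (rule sum.cong) (use ramp[OF uv(1)] ramp[OF uv(2)] in auto)
  also have "\<dots> = (\<Sum>j=1..i. of_int (jump \<tau> j) * (v - u))"
    by (rule sum.mono_neutral_cong_right) (use i in auto)
  finally show ?thesis
    unfolding slope_typesD(8)[OF \<tau>(1) i] by (simp add: distrib_right flip: sum_distrib_right)
qed

lemma in_some_segment:
  assumes "u \<notin> x ` {1..k}"
  obtains i where "i \<le> k" "u \<in> segment k x i"
proof -
  (* the last break point below u is the left end of the segment; 0 stands for the end at -\<infinity> *)
  define J where "J = {j. j \<le> k \<and> (j = 0 \<or> x j < u)}"
  have fin: "finite J" "J \<noteq> {}" by (auto simp: J_def)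
  have "Max J \<in> J" using fin by (rule Max_in)
  moreover have "Suc (Max J) \<notin> J" using Max_ge[OF fin(1)] by (metis Suc_n_not_le_n)
  ultimately have "Max J \<le> k" "u \<in> segment k x (Max J)"
    using assms by (force simp: J_def segment_def not_less)+
  then show thesis by (rule that)
qed

lemma open_segment_set: "open (segment k x i)"
proof -
  have "segment k x i = (if 1 \<le> i then {x i<..} else UNIV) \<inter> (if i < k then {..<x (Suc i)} else UNIV)"
    by (auto simp: segment_def)
  then show ?thesis by (simp add: open_Int)
qed

lemma at_minus_infty_ereal: "at (-\<infinity>) = filtermap ereal at_bot"
proof -
  have "{- \<infinity><..} = UNIV - {-\<infinity>::ereal}" by auto
  then show ?thesis using at_right_MInf by (metis at_within_def Diff_idemp)
qed

lemma tendsto_ereal_MInfty_iff: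
  "((\<lambda>x. ereal (f x)) \<longlongrightarrow> -\<infinity>) F \<longleftrightarrow> filterlim f at_bot F"
  by (simp add: tendsto_MInfty filterlim_at_bot_dense)

lemma continuous_proj_extend:
  assumes "continuous_on UNIV f" "filterlim f at_top at_top" "filterlim f at_bot at_bot"
  shows "continuous_on UNIV (proj_extend f)"
  unfolding continuous_on_eq_continuous_at[OF open_UNIV] isCont_def
proof
  fix e :: ereal
  show "proj_extend f \<midarrow>e\<rightarrow> proj_extend f e"
  proof (cases e)
    case (real r)
    have "f \<midarrow>r\<rightarrow> f r" using assms(1) by (simp add: continuous_on_eq_continuous_at isCont_def)
    then show ?thesis by (simp add: real at_ereal filterlim_filtermap)
  next
    case PInf
    show ?thesis using assms(2)
      by (simp add: PInf at_infty_ereal_eq_at_top filterlim_filtermap tendsto_PInfty_eq_at_top)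
  next
    case MInf
    show ?thesis using assms(3)
      by (simp add: MInf at_minus_infty_ereal filterlim_filtermap tendsto_ereal_MInfty_iff)
  qed
qed

text \<open>
  The maps of a given type with given breaks form one class modulo additive constants:
  the difference with the broken line is continuous and has derivative 0 off the breaks.
  The values at the points at infinity are then forced by continuity.
\<close>

lemma has_slopes_and_breaks_iff:
  assumes "\<tau> \<in> slope_types"
  shows "has_slopes_and_breaks \<tau> x \<phi> \<longleftrightarrow>
    strict_mono_on {1..nbreaks \<tau>} x \<and> (\<exists>c. \<phi> = proj_extend (\<lambda>u. broken_line \<tau> x u + c))"
proof
  assume "has_slopes_and_breaks \<tau> x \<phi>"
  then obtain f where mono: "strict_mono_on {1..nbreaks \<tau>} x" and cont: "continuous_on UNIV \<phi>"
    and f: "\<And>u. \<phi> (ereal u) = ereal (f u)"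
    and slope: "\<And>i u v. i \<le> nbreaks \<tau> \<Longrightarrow> u \<in> segment (nbreaks \<tau>) x i \<Longrightarrow> v \<in> segment (nbreaks \<tau>) x i
      \<Longrightarrow> f v - f u = of_int (\<tau> ! i) * (v - u)"
    unfolding has_slopes_and_breaks_def by metis
  have lim: "(\<phi> \<longlongrightarrow> \<phi> e) (at e)" for e
    using cont by (simp add: continuous_on_eq_continuous_at isCont_def)
  let ?g = "\<lambda>u. f u - broken_line \<tau> x u"
  have "isCont f u" for u
    using lim[of "ereal u"] by (simp add: at_ereal filterlim_filtermap f isCont_def)
  then have contg: "continuous_on UNIV ?g"
    by (intro continuous_intros continuous_broken_line) (simp add: continuous_on_eq_continuous_at)
  have deriv: "(?g has_real_derivative 0) (at u)" if u: "u \<notin> x ` {1..nbreaks \<tau>}" for u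
  proof -
    obtain i where i: "i \<le> nbreaks \<tau>" "u \<in> segment (nbreaks \<tau>) x i"
      using u by (rule in_some_segment)
    have "?g v = ?g u" if "v \<in> segment (nbreaks \<tau>) x i" for v
      using slope[OF i that] broken_line_slope[OF assms mono i that] by simp
    then show ?thesis
      by (intro has_field_derivative_transform_within_open[OF DERIV_const open_segment_set i(2)]) simp
  qed
  obtain c where c: "?g u = c" for u
  proof (rule DERIV_zero_connected_constant[of UNIV "x ` {1..nbreaks \<tau>}" ?g])
    show "\<forall>u\<in>UNIV - x ` {1..nbreaks \<tau>}. (?g has_real_derivative 0) (at u)" using deriv by blast
  qed (use contg that in auto)
  have fc: "f = (\<lambda>u. broken_line \<tau> x u + c)" using c by (auto simp: fun_eq_iff algebra_simps)
  have "((\<lambda>u. ereal (f u)) \<longlongrightarrow> \<phi> \<infinity>) at_top"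
    using lim[of \<infinity>] by (simp add: at_infty_ereal_eq_at_top filterlim_filtermap f)
  moreover have "((\<lambda>u. ereal (f u)) \<longlongrightarrow> \<infinity>) at_top"
    unfolding tendsto_PInfty_eq_at_top fc by (rule broken_line_limits[OF assms])
  ultimately have top: "\<phi> \<infinity> = \<infinity>" by (rule tendsto_unique[rotated]) simp
  have "((\<lambda>u. ereal (f u)) \<longlongrightarrow> \<phi> (-\<infinity>)) at_bot"
    using lim[of "-\<infinity>"] by (simp add: at_minus_infty_ereal filterlim_filtermap f)
  moreover have "((\<lambda>u. ereal (f u)) \<longlongrightarrow> -\<infinity>) at_bot"
    unfolding tendsto_ereal_MInfty_iff fc by (rule broken_line_limits[OF assms])
  ultimately have bot: "\<phi> (-\<infinity>) = -\<infinity>" by (rule tendsto_unique[rotated]) simp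
  have "\<phi> e = proj_extend f e" for e by (cases e) (use f top bot in auto)
  then show "strict_mono_on {1..nbreaks \<tau>} x \<and> (\<exists>c. \<phi> = proj_extend (\<lambda>u. broken_line \<tau> x u + c))"
    using mono fc by auto
next
  assume "strict_mono_on {1..nbreaks \<tau>} x \<and> (\<exists>c. \<phi> = proj_extend (\<lambda>u. broken_line \<tau> x u + c))"
  then obtain c where mono: "strict_mono_on {1..nbreaks \<tau>} x"
    and \<phi>: "\<phi> = proj_extend (\<lambda>u. broken_line \<tau> x u + c)" by blast
  have "continuous_on UNIV \<phi>"
    unfolding \<phi> by (intro continuous_proj_extend broken_line_limits assms continuous_intros continuous_broken_line)
  then show "has_slopes_and_breaks \<tau> x \<phi>"
    unfolding has_slopes_and_breaks_def using mono broken_line_slope[OF assms mono]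
    by (intro conjI exI[of _ "\<lambda>u. broken_line \<tau> x u + c"]) (auto simp: \<phi>)
qed


section \<open>Gluing of cells\<close>

definition cells :: "(int list \<times> cell_point) set" where
  "cells = Sigma slope_types partial_closed_cell"

definition point_map :: "int list \<times> cell_point \<Rightarrow> real \<Rightarrow> real" where
  "point_map q = broken_line (fst q) (break_point (snd q))"

definition first_break :: "int list \<times> cell_point \<Rightarrow> real" where
  "first_break q = break_point (snd q) 1"

definition last_break :: "int list \<times> cell_point \<Rightarrow> real" where
  "last_break q = break_point (snd q) (nbreaks (fst q))"

text \<open>
  How every quantity that is a sum over the breaks behaves under gluing. It is applied to the
  absolute values of the jumps and to the ramps.
\<close>

lemma sum_merge_adjacent:
  fixes g g' :: "nat \<Rightarrow> 'a::comm_monoid_add"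
  assumes "1 \<le> i" "Suc i \<le> k" "\<And>j. 1 \<le> j \<Longrightarrow> j < i \<Longrightarrow> g' j = g j"
    "g' i = g i + g (Suc i)" "\<And>j. i < j \<Longrightarrow> j < k \<Longrightarrow> g' j = g (Suc j)"
  shows "(\<Sum>j=1..k - 1. g' j) = (\<Sum>j=1..k. g j)"
  using assms(2,5)
proof (induction k rule: dec_induct)
  case base
  obtain i0 where i0: "i = Suc i0" using assms(1) by (cases i) auto
  have "(\<Sum>j=1..i0. g' j) = (\<Sum>j=1..i0. g j)"
    by (rule sum.cong) (use assms(3) i0 in auto)
  then show ?case using assms(4) i0 by (simp add: add.assoc)
next
  case (step k)
  obtain k0 where k0: "k = Suc k0" using step.hyps by (cases k) auto
  show ?case using step.IH step.prems step.hyps k0 by simp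
qed

lemma merge_sequence:
  fixes \<tau> :: "int list" and i
  defines "\<tau>' \<equiv> take i \<tau> @ drop (Suc i) \<tau>"
  assumes "1 \<le> i" "i < nbreaks \<tau>"
  shows "nbreaks \<tau>' = nbreaks \<tau> - 1" "\<tau>' \<noteq> []" "hd \<tau>' = hd \<tau>" "last \<tau>' = last \<tau>"
    "1 \<le> j \<Longrightarrow> j < i \<Longrightarrow> jump \<tau>' j = jump \<tau> j" "jump \<tau>' i = jump \<tau> i + jump \<tau> (Suc i)"
    "i < j \<Longrightarrow> j < nbreaks \<tau> \<Longrightarrow> jump \<tau>' j = jump \<tau> (Suc j)"
proof -
  have len: "Suc i < length \<tau>" using assms by (simp add: nbreaks_def)
  then show "nbreaks \<tau>' = nbreaks \<tau> - 1" "\<tau>' \<noteq> []" "hd \<tau>' = hd \<tau>" "last \<tau>' = last \<tau>"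
    using \<open>1 \<le> i\<close> by (cases \<tau>; auto simp: nbreaks_def \<tau>'_def)+
  have nth: "\<tau>' ! j = (if j < i then \<tau> ! j else \<tau> ! Suc j)" if "j < nbreaks \<tau>" for j
    using that len by (auto simp: \<tau>'_def nth_append nbreaks_def min_def)
  show "jump \<tau>' j = jump \<tau> j" if "1 \<le> j" "j < i"
  proof -
    have "j - 1 < i" "j < nbreaks \<tau>" "j - 1 < nbreaks \<tau>" using that assms by linarith+
    then show ?thesis using that nth by (simp only: jump_def if_True)
  qed
  show "jump \<tau>' i = jump \<tau> i + jump \<tau> (Suc i)"
    using nth[of i] nth[of "i - 1"] assms by (simp add: jump_def)
  show "jump \<tau>' j = jump \<tau> (Suc j)" if "i < j" "j < nbreaks \<tau>"
    using that nth[of j] nth[of "j - 1"] assms by (auto simp: jump_def)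
qed

lemma break_point_Suc: "1 \<le> i \<Longrightarrow> break_point p (Suc i) = break_point p i + fst p i"
  by (simp add: break_point_def)

lemma break_point_1 [simp]: "break_point p 1 = snd p" "break_point p (Suc 0) = snd p"
  by (simp_all add: break_point_def)

lemma break_point_merge:
  assumes "1 \<le> i" "l i = 0" "1 \<le> j"
  shows "break_point (\<lambda>j. if j < i then l j else l (Suc j), t) j
    = (if j \<le> i then break_point (l, t) j else break_point (l, t) (Suc j))"
  using assms(3)
proof (induction j rule: dec_induct)
  case base
  then show ?case using assms(1) by simp
next
  case (step j)
  then show ?case using assms(1,2) by (auto simp: break_point_Suc not_less_eq_eq le_Suc_eq)
qed

text \<open>
  Gluing merges two jumps of equal sign at one and the same point. This changes neither
  the broken line nor the total variation of the slope nor the extreme breaks, and the merged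
  jump keeps the sign, so that the remaining faces stay admissible.
\<close>

lemma glue_cells:
  assumes "glue q q'" "q \<in> cells"
  shows "q' \<in> cells" "nbreaks (fst q') < nbreaks (fst q)" "point_map q' = point_map q"
    "first_break q' = first_break q" "last_break q' = last_break q"
  using assms
proof (atomize (full), induction rule: glue.induct)
  case (1 i \<tau> l t)
  define \<tau>' where "\<tau>' = take i \<tau> @ drop (Suc i) \<tau>"
  define l' where "l' = (\<lambda>j. if j < i then l j else l (Suc j))"
  let ?k = "nbreaks \<tau>"
  note merge = merge_sequence[OF 1(1,2), folded \<tau>'_def]
  have \<tau>: "\<tau> \<in> slope_types" and p: "(l, t) \<in> partial_closed_cell \<tau>"
    using 1(5) by (auto simp: cells_def)
  have bp: "break_point (l', t) j = (if j \<le> i then break_point (l, t) j else break_point (l, t) (Suc j))"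
    if "1 \<le> j" for j
    unfolding l'_def using 1(1,3) that by (rule break_point_merge)
  have sum: "(\<Sum>j=1..nbreaks \<tau>'. g (jump \<tau>' j) (break_point (l', t) j))
      = (\<Sum>j=1..?k. g (jump \<tau> j) (break_point (l, t) j))"
    if "\<And>x. g (jump \<tau> i + jump \<tau> (Suc i)) x = g (jump \<tau> i) x + g (jump \<tau> (Suc i)) x"
    for g :: "int \<Rightarrow> real \<Rightarrow> 'z::comm_monoid_add"
    unfolding merge(1)
    by (rule sum_merge_adjacent[of i])
      (use 1(1-3) merge(5-7) bp that in \<open>auto simp: break_point_Suc\<close>)
  have same_sign: "0 < jump \<tau> i \<and> 0 < jump \<tau> (Suc i) \<or> jump \<tau> i < 0 \<and> jump \<tau> (Suc i) < 0"
    using 1(4) by (simp add: zero_less_mult_iff)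
  have "(\<Sum>j=1..nbreaks \<tau>'. \<bar>jump \<tau>' j\<bar>) = 4"
    using sum[of "\<lambda>d _. \<bar>d\<bar>"] same_sign slope_typesD(6)[OF \<tau>] by auto
  moreover have "jump \<tau>' j \<noteq> 0" if "j \<in> {1..nbreaks \<tau>'}" for j
  proof -
    consider "j < i" | "j = i" | "i < j" by linarith
    then show ?thesis
      by cases (use that merge slope_typesD(5)[OF \<tau>] same_sign 1(1,2) in auto)
  qed
  ultimately have "\<tau>' \<in> slope_types"
    using \<tau> merge(2-4) by (auto simp: slope_types_def)
  moreover have "(l', t) \<in> partial_closed_cell \<tau>'"
  proof -
    have pos: "0 \<le> l j" "l j = 0 \<Longrightarrow> jump \<tau> j * jump \<tau> (Suc j) > 0" if "1 \<le> j" "j < ?k" for j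
      using p that by (auto simp: partial_closed_cell_def)
    have out: "l j = 0" if "j \<notin> {1..<?k}" for j
      using p that by (auto simp: partial_closed_cell_def)
    have "jump \<tau>' j * jump \<tau>' (Suc j) > 0" if j: "j \<in> {1..<nbreaks \<tau>'}" "l' j = 0" for j
    proof -
      consider "Suc j < i" | "Suc j = i" | "j = i" | "i < j" by linarith
      then show ?thesis
      proof cases
        case 1
        then show ?thesis using pos(2)[of j] j merge \<open>i < ?k\<close> by (auto simp: l'_def)
      next
        case 2
        then have "jump \<tau> j * jump \<tau> i > 0" using pos(2)[of j] j \<open>i < ?k\<close> by (auto simp: l'_def)
        then show ?thesis using 2 merge(5)[of j] merge(6) same_sign j by (auto simp: zero_less_mult_iff)
      next
        case 3
        then have "jump \<tau> (Suc i) * jump \<tau> (Suc (Suc i)) > 0"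
          using pos(2)[of "Suc j"] j merge(1) by (auto simp: l'_def)
        moreover have "jump \<tau>' (Suc j) = jump \<tau> (Suc (Suc j))"
          using 3 merge(1) j by (intro merge(7)) auto
        ultimately show ?thesis using 3 merge(6) same_sign by (auto simp: zero_less_mult_iff)
      next
        case 4
        then show ?thesis using pos(2)[of "Suc j"] j merge by (auto simp: l'_def)
      qed
    qed
    moreover have "l' j \<ge> 0" if "j \<in> {1..<nbreaks \<tau>'}" for j
      using that pos(1)[of j] pos(1)[of "Suc j"] merge(1) by (auto simp: l'_def)
    moreover have "l' j = 0" if "j \<notin> {1..<nbreaks \<tau>'}" for j
      using that out[of j] out[of "Suc j"] merge(1) 1(1,2) by (auto simp: l'_def)
    ultimately show ?thesis by (auto simp: partial_closed_cell_def)
  qed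
  moreover have "point_map (\<tau>', l', t) = point_map (\<tau>, l, t)"
    using sum[of "\<lambda>d x. of_int d * max 0 (_ - x)"]
    by (auto simp: point_map_def broken_line_def fun_eq_iff distrib_right)
  moreover have "last_break (\<tau>', l', t) = last_break (\<tau>, l, t)"
    using bp[of "?k - 1"] 1(1-3) merge(1) break_point_Suc[OF 1(1), of "(l, t)"]
      Suc_diff_1[of ?k]
    by (cases "?k - 1 = i") (auto simp: last_break_def simp del: One_nat_def)
  ultimately show ?case
    using merge(1) 1(2) by (simp add: cells_def first_break_def flip: \<tau>'_def l'_def)
qed

lemma glue_rtranclp_cells:
  assumes "glue\<^sup>*\<^sup>* q q'" "q \<in> cells"
  shows "q' \<in> cells \<and> point_map q' = point_map q \<and> first_break q' = first_break q \<and> last_break q' = last_break q"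
  using assms by (induction rule: rtranclp_induct) (auto simp: glue_cells)

lemma open_cell_subset: "open_cell \<tau> \<subseteq> partial_closed_cell \<tau>"
  by (auto simp: open_cell_def partial_closed_cell_def less_imp_le)

lemma open_cells: "\<tau> \<in> slope_types \<Longrightarrow> p \<in> open_cell \<tau> \<Longrightarrow> (\<tau>, p) \<in> cells"
  using open_cell_subset by (auto simp: cells_def)

text \<open>
  A vanishing gap can be merged, and each merging lowers the number of breaks.
\<close>

lemma glue_to_open_cell:
  assumes "q \<in> cells"
  shows "\<exists>\<tau> p. glue\<^sup>*\<^sup>* q (\<tau>, p) \<and> p \<in> open_cell \<tau>"
  using assms
proof (induction "nbreaks (fst q)" arbitrary: q rule: less_induct)
  case less
  obtain \<tau> l t where q: "q = (\<tau>, l, t)" by (metis prod.exhaust)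
  show ?case
  proof (cases "(l, t) \<in> open_cell \<tau>")
    case True
    then show ?thesis using q by blast
  next
    case False
    with less.prems obtain i where "i \<in> {1..<nbreaks \<tau>}" "l i = 0" "jump \<tau> i * jump \<tau> (Suc i) > 0"
      by (force simp: q cells_def partial_closed_cell_def open_cell_def)
    then obtain q' where q': "glue q q'"
      using glue.intros[of i \<tau> l t] q by auto
    then obtain \<tau>' p' where "glue\<^sup>*\<^sup>* q' (\<tau>', p')" "p' \<in> open_cell \<tau>'"
      using less.hyps glue_cells[OF q' less.prems] by blast
    then show ?thesis using q' by (meson converse_rtranclp_into_rtranclp)
  qed
qed

lemma strict_mono_break_point:
  assumes "p \<in> open_cell \<tau>"
  shows "strict_mono_on {1..nbreaks \<tau>} (break_point p)"
proof (rule strict_mono_onI)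
  fix r s assume rs: "r \<in> {1..nbreaks \<tau>}" "s \<in> {1..nbreaks \<tau>}" "r < s"
  have "(\<Sum>j=r..<s. fst p j) > 0"
    by (rule sum_pos) (use assms rs in \<open>auto simp: open_cell_def\<close>)
  moreover have "(\<Sum>j=1..<s. fst p j) = (\<Sum>j=1..<r. fst p j) + (\<Sum>j=r..<s. fst p j)"
    using rs by (simp add: sum.atLeastLessThan_concat)
  ultimately show "break_point p r < break_point p s" by (simp add: break_point_def)
qed

definition map_class :: "(real \<Rightarrow> real) \<Rightarrow> (ereal \<Rightarrow> ereal) set" where
  "map_class f = range (\<lambda>c. proj_extend (\<lambda>u. f u + c))"

text \<open>
  The broken line is a gluing invariant, so the class does not depend on the order in
  which the vanishing gaps are merged.
\<close>

lemma moduli_point_eq: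
  assumes "q \<in> cells"
  shows "moduli_point q = map_class (point_map q)"
proof (intro equalityI subsetI)
  fix \<phi> assume "\<phi> \<in> moduli_point q"
  then obtain \<tau> p where glue: "glue\<^sup>*\<^sup>* q (\<tau>, p)" and \<phi>: "has_slopes_and_breaks \<tau> (break_point p) \<phi>"
    by (auto simp: moduli_point_def)
  have "(\<tau>, p) \<in> cells" "point_map (\<tau>, p) = point_map q"
    using glue_rtranclp_cells[OF glue assms] by auto
  then show "\<phi> \<in> map_class (point_map q)"
    using \<phi> has_slopes_and_breaks_iff[of \<tau>]
    by (auto simp: cells_def map_class_def point_map_def)
next
  fix \<phi> assume \<phi>: "\<phi> \<in> map_class (point_map q)"
  obtain \<tau> p where glue: "glue\<^sup>*\<^sup>* q (\<tau>, p)" and p: "p \<in> open_cell \<tau>"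
    using glue_to_open_cell[OF assms] by blast
  have "(\<tau>, p) \<in> cells" "point_map (\<tau>, p) = point_map q"
    using glue_rtranclp_cells[OF glue assms] by auto
  then have "has_slopes_and_breaks \<tau> (break_point p) \<phi>"
    using \<phi> has_slopes_and_breaks_iff[of \<tau>] strict_mono_break_point[OF p]
    by (auto simp: cells_def map_class_def point_map_def)
  then show "\<phi> \<in> moduli_point q" using glue p unfolding moduli_point_def by blast
qed

lemma map_class_eq_iff: "map_class f = map_class g \<longleftrightarrow> (\<exists>c. \<forall>u. f u = g u + c)"
proof
  assume "map_class f = map_class g"
  then have "proj_extend (\<lambda>u. f u + 0) \<in> map_class g" unfolding map_class_def by blast
  then show "\<exists>c. \<forall>u. f u = g u + c" by (auto simp: map_class_def proj_extend_eq_iff dest: fun_cong)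
next
  assume "\<exists>c. \<forall>u. f u = g u + c"
  then obtain c where c: "\<And>u. f u = g u + c" by blast
  have "f = (\<lambda>u. g u + c)" using c by auto
  then have "proj_extend (\<lambda>u. f u + d) = proj_extend (\<lambda>u. g u + (c + d))"
    "proj_extend (\<lambda>u. g u + d) = proj_extend (\<lambda>u. f u + (d - c))" for d
    unfolding proj_extend_eq_iff by (simp_all add: fun_eq_iff)
  then show "map_class f = map_class g" unfolding map_class_def by blast
qed

text \<open>
  The open cells map injectively to the moduli space, with disjoint images.
\<close>

lemma moduli_point_unique:
  assumes "\<tau> \<in> slope_types" "p \<in> open_cell \<tau>" "\<tau>' \<in> slope_types" "p' \<in> open_cell \<tau>'"
    and "moduli_point (\<tau>, p) = moduli_point (\<tau>', p')"
  shows "\<tau>' = \<tau> \<and> p' = p"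
proof -
  have "map_class (point_map (\<tau>', p')) = map_class (point_map (\<tau>, p))"
    using assms by (simp add: moduli_point_eq open_cells)
  then obtain c where c: "\<And>u. broken_line \<tau>' (break_point p') u = broken_line \<tau> (break_point p) u + c"
    by (auto simp: map_class_eq_iff point_map_def)
  note unique = broken_line_unique[OF assms(1) strict_mono_break_point[OF assms(2)]
      assms(3) strict_mono_break_point[OF assms(4)] c]
  have "snd p = snd p'"
    using unique(2)[of 1] slope_typesD(9)[OF assms(1)] by simp
  moreover have "fst p i = fst p' i" for i
  proof (cases "i \<in> {1..<nbreaks \<tau>}")
    case True
    then have "break_point p (Suc i) = break_point p' (Suc i)" "break_point p i = break_point p' i"
      by (auto intro!: unique(2))
    then show ?thesis using True by (simp add: break_point_Suc)
  next
    case False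
    then show ?thesis using assms(2,4) unique(1) by (auto simp: open_cell_def)
  qed
  ultimately show ?thesis using unique(1) by (auto simp: prod_eq_iff)
qed


section \<open>Automorphisms of the projective line\<close>

definition affine_aut :: "real \<Rightarrow> real \<Rightarrow> ereal \<Rightarrow> ereal" where
  "affine_aut \<epsilon> b = (\<lambda>x. ereal \<epsilon> * x + ereal b)"

lemma affine_aut_real [simp]: "affine_aut \<epsilon> b (ereal u) = ereal (\<epsilon> * u + b)"
  by (simp add: affine_aut_def)

lemma affine_aut_infinity [simp]:
  "affine_aut 1 b \<infinity> = \<infinity>" "affine_aut 1 b (-\<infinity>) = -\<infinity>"
  "affine_aut (-1) b \<infinity> = -\<infinity>" "affine_aut (-1) b (-\<infinity>) = \<infinity>"
  by (simp_all add: affine_aut_def)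

lemma carrier_TP1_aut: "carrier TP1_aut = {affine_aut \<epsilon> b |\<epsilon> b. \<epsilon> \<in> {1, -1}}"
  unfolding TP1_aut_def affine_aut_def partial_object.simps by blast

lemma affine_aut_compose:
  assumes "\<epsilon> \<in> {1, -1}" "\<epsilon>' \<in> {1, -1}"
  shows "affine_aut \<epsilon> b \<circ> affine_aut \<epsilon>' b' = affine_aut (\<epsilon> * \<epsilon>') (\<epsilon> * b' + b)"
proof
  fix x show "(affine_aut \<epsilon> b \<circ> affine_aut \<epsilon>' b') x = affine_aut (\<epsilon> * \<epsilon>') (\<epsilon> * b' + b) x"
    using assms by (cases x) (auto simp: algebra_simps)
qed

lemma affine_aut_id: "affine_aut 1 0 = id"
proof
  fix x show "affine_aut 1 0 x = id x" by (cases x) auto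
qed

lemma affine_aut_eq_iff: "affine_aut \<epsilon> b = affine_aut \<epsilon>' b' \<longleftrightarrow> \<epsilon> = \<epsilon>' \<and> b = b'"
proof
  assume eq: "affine_aut \<epsilon> b = affine_aut \<epsilon>' b'"
  from fun_cong[OF eq, of "ereal 0"] fun_cong[OF eq, of "ereal 1"]
  show "\<epsilon> = \<epsilon>' \<and> b = b'" by (simp del: zero_ereal_def one_ereal_def)
qed simp


section \<open>Points of the moduli space\<close>

text \<open>
  The coordinates of the map are the gaps between consecutive breaks and the first break.
\<close>

lemma in_deg3_mapsE:
  assumes "\<phi> \<in> deg3_maps"
  obtains \<tau> p c where "\<tau> \<in> slope_types" "p \<in> open_cell \<tau>"
    "\<phi> = proj_extend (\<lambda>u. point_map (\<tau>, p) u + c)"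
proof -
  obtain \<tau> x c where \<tau>: "\<tau> \<in> slope_types" and x: "strict_mono_on {1..nbreaks \<tau>} x"
    and \<phi>: "\<phi> = proj_extend (\<lambda>u. broken_line \<tau> x u + c)"
    using assms by (auto simp: deg3_maps_def has_slopes_and_breaks_iff)
  define l where "l i = (if i \<in> {1..<nbreaks \<tau>} then x (Suc i) - x i else 0)" for i
  have "l i > 0" if "i \<in> {1..<nbreaks \<tau>}" for i
    using that strict_mono_onD[OF x, of i "Suc i"] by (simp add: l_def)
  then have p: "(l, x 1) \<in> open_cell \<tau>" by (auto simp: open_cell_def l_def)
  have "break_point (l, x 1) i = x i" if "1 \<le> i" "i \<le> nbreaks \<tau>" for i
    using that by (induction i rule: dec_induct) (auto simp: break_point_Suc l_def)
  then have "point_map (\<tau>, l, x 1) = broken_line \<tau> x"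
    by (auto simp: point_map_def broken_line_def fun_eq_iff)
  with \<tau> p \<phi> show thesis by (intro that[of \<tau> "(l, x 1)" c]) auto
qed

lemma open_cell_maps_deg3:
  assumes "\<tau> \<in> slope_types" "p \<in> open_cell \<tau>"
  shows "proj_extend (\<lambda>u. point_map (\<tau>, p) u + c) \<in> deg3_maps"
  using assms strict_mono_break_point[OF assms(2)]
  by (auto simp: deg3_maps_def has_slopes_and_breaks_iff point_map_def)

text \<open>
  Post-composition with an orientation reversing automorphism exchanges the points at
  infinity and so never leads to another map of degree 3. Hence a class consists of the maps
  that differ by an additive constant.
\<close>

lemma deg3_quotient: "deg3_maps // postcomp_rel = {moduli_point (\<tau>, p) |\<tau> p. \<tau> \<in> slope_types \<and> p \<in> open_cell \<tau>}"
proof -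
  have "postcomp_rel `` {proj_extend (\<lambda>u. point_map (\<tau>, p) u + c)} = moduli_point (\<tau>, p)"
    if \<tau>: "\<tau> \<in> slope_types" "p \<in> open_cell \<tau>" for \<tau> p c
  proof -
    let ?f = "\<lambda>u. point_map (\<tau>, p) u + c"
    have "\<psi> \<in> map_class (point_map (\<tau>, p))"
      if "\<psi> \<in> deg3_maps" "\<beta> \<in> carrier TP1_aut" and \<psi>: "\<psi> = \<beta> \<circ> proj_extend ?f" for \<psi> \<beta>
    proof -
      obtain \<epsilon> b where \<epsilon>: "\<epsilon> \<in> {1, -1}" and \<beta>: "\<beta> = affine_aut \<epsilon> b"
        using \<open>\<beta> \<in> carrier TP1_aut\<close> unfolding carrier_TP1_aut by blast
      (* every map of degree 3 fixes the points at infinity, which excludes the sign -1 *)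
      have "\<psi> \<infinity> = \<infinity>" using \<open>\<psi> \<in> deg3_maps\<close> by (auto elim: in_deg3_mapsE)
      then have "\<epsilon> = 1" using \<epsilon> \<psi> \<beta> by auto
      have "\<psi> x = proj_extend (\<lambda>u. point_map (\<tau>, p) u + (c + b)) x" for x
        by (cases x) (auto simp: \<psi> \<beta> \<open>\<epsilon> = 1\<close>)
      then show ?thesis by (auto simp: map_class_def)
    qed
    moreover have "(proj_extend ?f, \<psi>) \<in> postcomp_rel" if \<psi>: "\<psi> \<in> map_class (point_map (\<tau>, p))" for \<psi>
    proof -
      obtain d where d: "\<psi> = proj_extend (\<lambda>u. point_map (\<tau>, p) u + d)"
        using \<psi> by (auto simp: map_class_def)
      have "\<psi> x = (affine_aut 1 (d - c) \<circ> proj_extend ?f) x" for x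
        by (cases x) (auto simp: d)
      then have "\<psi> = affine_aut 1 (d - c) \<circ> proj_extend ?f" by blast
      moreover have "affine_aut 1 (d - c) \<in> carrier TP1_aut" by (auto simp: carrier_TP1_aut)
      moreover have "\<psi> \<in> deg3_maps" unfolding d by (rule open_cell_maps_deg3[OF \<tau>])
      ultimately show ?thesis
        using open_cell_maps_deg3[OF \<tau>, of c] unfolding postcomp_rel_def by auto
    qed
    ultimately show ?thesis
      unfolding moduli_point_eq[OF open_cells[OF \<tau>]] by (auto simp: postcomp_rel_def)
  qed
  note quotient_class = this
  show ?thesis
  proof (intro equalityI subsetI)
    fix c assume "c \<in> deg3_maps // postcomp_rel"
    then obtain \<phi> where \<phi>: "\<phi> \<in> deg3_maps" "c = postcomp_rel `` {\<phi>}" by (auto elim: quotientE)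
    obtain \<tau> p d where "\<tau> \<in> slope_types" "p \<in> open_cell \<tau>"
      and "\<phi> = proj_extend (\<lambda>u. point_map (\<tau>, p) u + d)"
      using \<phi>(1) by (rule in_deg3_mapsE)
    then show "c \<in> {moduli_point (\<tau>, p) |\<tau> p. \<tau> \<in> slope_types \<and> p \<in> open_cell \<tau>}"
      using quotient_class \<phi>(2) by blast
  next
    fix c assume "c \<in> {moduli_point (\<tau>, p) |\<tau> p. \<tau> \<in> slope_types \<and> p \<in> open_cell \<tau>}"
    then obtain \<tau> p where \<tau>: "\<tau> \<in> slope_types" "p \<in> open_cell \<tau>" and c: "c = moduli_point (\<tau>, p)" by auto
    show "c \<in> deg3_maps // postcomp_rel"
      unfolding c quotient_class[OF \<tau>, of 0, symmetric] by (rule quotientI[OF open_cell_maps_deg3[OF \<tau>]])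
  qed
qed

text \<open>
  Statements about arbitrary points of the partially closed cells that depend only on the broken
  line and its extreme breaks reduce to open cells.
\<close>

lemma open_representative:
  assumes "q \<in> cells"
  obtains \<tau> p where "\<tau> \<in> slope_types" "p \<in> open_cell \<tau>" "moduli_point (\<tau>, p) = moduli_point q"
    "point_map (\<tau>, p) = point_map q" "first_break (\<tau>, p) = first_break q" "last_break (\<tau>, p) = last_break q"
proof -
  obtain \<tau> p where glue: "glue\<^sup>*\<^sup>* q (\<tau>, p)" and p: "p \<in> open_cell \<tau>"
    using glue_to_open_cell[OF assms] by blast
  show thesis
    by (rule that[of \<tau> p])
      (use glue_rtranclp_cells[OF glue assms] p assms in \<open>auto simp: cells_def moduli_point_eq\<close>)
qed

lemma moduli_point_in_quotient: "q \<in> cells \<Longrightarrow> moduli_point q \<in> deg3_maps // postcomp_rel"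
  by (erule open_representative) (auto simp: deg3_quotient)


section \<open>Automorphism groups\<close>

lemma map_aut_simps [simp]:
  "\<alpha>\<beta> \<otimes>\<^bsub>map_aut \<phi>\<^esub> \<alpha>\<beta>' = (fst \<alpha>\<beta> \<circ> fst \<alpha>\<beta>', snd \<alpha>\<beta> \<circ> snd \<alpha>\<beta>')"
  "\<one>\<^bsub>map_aut \<phi>\<^esub> = (id, id)"
  by (simp_all add: map_aut_def DirProd_def TP1_aut_def split_def)

lemma in_carrier_map_aut:
  "(\<alpha>, \<beta>) \<in> carrier (map_aut \<phi>) \<longleftrightarrow>
    \<alpha> \<in> carrier TP1_aut \<and> \<beta> \<in> carrier TP1_aut \<and> \<beta> \<circ> \<phi> = \<phi> \<circ> \<alpha>"
  by (simp add: map_aut_def DirProd_def)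

lemma TP1_aut_closed: "\<alpha> \<in> carrier TP1_aut \<Longrightarrow> \<beta> \<in> carrier TP1_aut \<Longrightarrow> \<alpha> \<circ> \<beta> \<in> carrier TP1_aut"
  unfolding carrier_TP1_aut by (fastforce simp: affine_aut_compose)

lemma id_TP1_aut: "id \<in> carrier TP1_aut"
  unfolding affine_aut_id[symmetric] carrier_TP1_aut by blast

lemma TP1_aut_inverse:
  assumes "\<alpha> \<in> carrier TP1_aut"
  obtains \<alpha>' where "\<alpha>' \<in> carrier TP1_aut" "\<alpha>' \<circ> \<alpha> = id" "\<alpha> \<circ> \<alpha>' = id"
proof -
  obtain \<epsilon> b where \<epsilon>: "\<epsilon> \<in> {1, -1}" "\<alpha> = affine_aut \<epsilon> b" using assms by (auto simp: carrier_TP1_aut)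
  show thesis
    by (rule that[of "affine_aut \<epsilon> (- \<epsilon> * b)"])
      (use \<epsilon> in \<open>auto simp: carrier_TP1_aut affine_aut_compose simp flip: affine_aut_id\<close>)
qed

lemma group_map_aut: "group (map_aut \<phi>)"
proof (rule groupI)
  fix x y assume "x \<in> carrier (map_aut \<phi>)" "y \<in> carrier (map_aut \<phi>)"
  then show "x \<otimes>\<^bsub>map_aut \<phi>\<^esub> y \<in> carrier (map_aut \<phi>)"
    by (cases x; cases y) (auto simp: in_carrier_map_aut TP1_aut_closed, metis comp_assoc)
next
  show "\<one>\<^bsub>map_aut \<phi>\<^esub> \<in> carrier (map_aut \<phi>)" by (simp add: in_carrier_map_aut id_TP1_aut)
next
  fix x assume "x \<in> carrier (map_aut \<phi>)"
  then obtain \<alpha> \<beta> where x: "x = (\<alpha>, \<beta>)" and \<alpha>: "\<alpha> \<in> carrier TP1_aut" "\<beta> \<in> carrier TP1_aut"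
    and comm: "\<beta> \<circ> \<phi> = \<phi> \<circ> \<alpha>" by (cases x) (auto simp: in_carrier_map_aut)
  obtain \<alpha>' where \<alpha>': "\<alpha>' \<in> carrier TP1_aut" "\<alpha>' \<circ> \<alpha> = id" "\<alpha> \<circ> \<alpha>' = id"
    using \<alpha>(1) by (rule TP1_aut_inverse)
  obtain \<beta>' where \<beta>': "\<beta>' \<in> carrier TP1_aut" "\<beta>' \<circ> \<beta> = id" "\<beta> \<circ> \<beta>' = id"
    using \<alpha>(2) by (rule TP1_aut_inverse)
  have "\<beta>' \<circ> \<phi> = \<beta>' \<circ> (\<phi> \<circ> \<alpha>) \<circ> \<alpha>'" using \<alpha>'(3) by (simp add: comp_assoc)
  also have "\<dots> = (\<beta>' \<circ> \<beta>) \<circ> \<phi> \<circ> \<alpha>'" by (simp only: comp_assoc flip: comm)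
  finally have "\<beta>' \<circ> \<phi> = \<phi> \<circ> \<alpha>'" using \<beta>'(2) by simp
  then show "\<exists>y\<in>carrier (map_aut \<phi>). y \<otimes>\<^bsub>map_aut \<phi>\<^esub> x = \<one>\<^bsub>map_aut \<phi>\<^esub>"
    using x \<alpha>' \<beta>' by (intro bexI[of _ "(\<alpha>', \<beta>')"]) (auto simp: in_carrier_map_aut)
qed (auto simp: comp_assoc)

text \<open>
  The points at infinity, fixed by the map, force the two signs to agree.
\<close>

lemma affine_auts_in_map_aut:
  assumes "\<epsilon> \<in> {1, -1}" "\<epsilon>' \<in> {1, -1}"
  shows "(affine_aut \<epsilon> b, affine_aut \<epsilon>' c) \<in> carrier (map_aut (proj_extend f)) \<longleftrightarrow>
    \<epsilon> = \<epsilon>' \<and> (\<forall>u. f (\<epsilon> * u + b) = \<epsilon> * f u + c)"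
proof -
  have "affine_aut \<epsilon>' c \<circ> proj_extend f = proj_extend f \<circ> affine_aut \<epsilon> b \<longleftrightarrow>
      \<epsilon> = \<epsilon>' \<and> (\<forall>u. f (\<epsilon> * u + b) = \<epsilon> * f u + c)" (is "?lhs \<longleftrightarrow> ?rhs")
  proof
    assume ?lhs
    then have eq: "affine_aut \<epsilon>' c (proj_extend f x) = proj_extend f (affine_aut \<epsilon> b x)" for x
      by (simp add: fun_eq_iff)
    from eq[of \<infinity>] have "\<epsilon> = \<epsilon>'" using assms by auto
    moreover have "f (\<epsilon> * u + b) = \<epsilon>' * f u + c" for u using eq[of "ereal u"] by simp
    ultimately show ?rhs by simp
  next
    assume rhs: ?rhs
    show ?lhs
    proof
      fix x show "(affine_aut \<epsilon>' c \<circ> proj_extend f) x = (proj_extend f \<circ> affine_aut \<epsilon> b) x"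
        using rhs assms by (cases x) auto
    qed
  qed
  moreover have "affine_aut \<epsilon> b \<in> carrier TP1_aut" "affine_aut \<epsilon>' c \<in> carrier TP1_aut"
    using assms unfolding carrier_TP1_aut by blast+
  ultimately show ?thesis by (simp add: in_carrier_map_aut)
qed

lemma group_of_two_elements_iso:
  fixes G (structure)
  assumes "group G" "carrier G = {\<one>, a}" "a \<noteq> \<one>"
  shows "G \<cong> integer_mod_group 2"
proof -
  interpret group G by fact
  have a: "a \<in> carrier G" using assms(2) by simp
  have "a \<otimes> a \<noteq> a" using assms(3) a by (simp add: l_cancel_one)
  then have aa: "a \<otimes> a = \<one>" using m_closed[OF a a] assms(2) by auto
  define h where "h x = (if x = \<one> then 0 else 1 :: int)" for x
  have "h \<in> hom G (integer_mod_group 2)"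
    using assms(2,3) aa a by (auto simp: hom_def h_def carrier_integer_mod_group)
  moreover have "bij_betw h (carrier G) (carrier (integer_mod_group 2))"
  proof -
    have "{0..<2::int} = {0, 1}" by auto
    then show ?thesis
      using assms(2,3) by (auto simp: bij_betw_def inj_on_def h_def carrier_integer_mod_group)
  qed
  ultimately show ?thesis unfolding is_iso_def iso_def by blast
qed

lemma trivial_group_not_iso_Z2:
  assumes "trivial_group G"
  shows "\<not> G \<cong> integer_mod_group 2"
  using assms iso_same_card[of G "integer_mod_group 2"]
  by (auto simp: trivial_group_def carrier_integer_mod_group)

text \<open>
  If no translation is a symmetry, then two reflections that are symmetries coincide, because
  they differ by a translation. So at most one nontrivial automorphism remains.
\<close>

lemma map_aut_dichotomy:
  assumes rigid: "\<And>b c. (\<And>u. f (u + b) = f u + c) \<Longrightarrow> b = 0 \<and> c = 0"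
  shows "trivial_group (map_aut (proj_extend f)) \<longleftrightarrow> \<not> odd_symmetric f"
    "map_aut (proj_extend f) \<cong> integer_mod_group 2 \<longleftrightarrow> odd_symmetric f"
proof -
  let ?G = "map_aut (proj_extend f)"
  have cases: "x = (id, id) \<or> (\<exists>b c. x = (affine_aut (-1) b, affine_aut (-1) c) \<and> (\<forall>u. f (b - u) = c - f u))"
    if x: "x \<in> carrier ?G" for x
  proof -
    obtain \<alpha> \<beta> where ab: "x = (\<alpha>, \<beta>)" "\<alpha> \<in> carrier TP1_aut" "\<beta> \<in> carrier TP1_aut"
      using x by (cases x) (auto simp: in_carrier_map_aut)
    then obtain \<epsilon> b \<epsilon>' c where x': "x = (affine_aut \<epsilon> b, affine_aut \<epsilon>' c)"
      and signs: "\<epsilon> \<in> {1, -1}" "\<epsilon>' \<in> {1, -1}"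
      unfolding carrier_TP1_aut by blast
    have \<epsilon>: "\<epsilon> = \<epsilon>'" and f: "f (\<epsilon> * u + b) = \<epsilon> * f u + c" for u
      using x unfolding x' affine_auts_in_map_aut[OF signs] by auto
    consider "\<epsilon> = 1" | "\<epsilon> = -1" using signs(1) by auto
    then show ?thesis
    proof cases
      case 1
      then show ?thesis using rigid[of b c] f x' \<epsilon> by (simp add: affine_aut_id)
    next
      case 2
      have "f (b - u) = c - f u" for u using f[of u] 2 by (simp add: algebra_simps)
      then show ?thesis using x' \<epsilon> 2 by blast
    qed
  qed
  have one: "(id, id) \<in> carrier ?G" by (simp add: in_carrier_map_aut id_TP1_aut)
  have trivial: "trivial_group ?G" if "\<not> odd_symmetric f"
  proof -
    have "carrier ?G = {(id, id)}" using that cases one unfolding odd_symmetric_def by blast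
    then show ?thesis by (simp add: trivial_group_def group_map_aut)
  qed
  have Z2: "?G \<cong> integer_mod_group 2" if sym: "odd_symmetric f"
  proof -
    obtain b c where bc: "\<And>u. f (b - u) = c - f u" using sym by (auto simp: odd_symmetric_def)
    let ?a = "(affine_aut (-1) b, affine_aut (-1) c)"
    have unique: "b' = b \<and> c' = c" if bc': "\<And>u. f (b' - u) = c' - f u" for b' c'
    proof -
      have "f (u + (b' - b)) = f u + (c' - c)" for u
        using bc'[of "b - u"] bc[of u] by (simp add: algebra_simps)
      from rigid[OF this] show ?thesis by simp
    qed
    have "?a \<in> carrier ?G" by (subst affine_auts_in_map_aut) (use bc in \<open>auto simp: algebra_simps\<close>)
    moreover have "x \<in> {(id, id), ?a}" if "x \<in> carrier ?G" for x
    proof -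
      from cases[OF that] show ?thesis
      proof
        assume "\<exists>b' c'. x = (affine_aut (-1) b', affine_aut (-1) c') \<and> (\<forall>u. f (b' - u) = c' - f u)"
        then obtain b' c' where x: "x = (affine_aut (-1) b', affine_aut (-1) c')"
          and b': "\<And>u. f (b' - u) = c' - f u" by blast
        show ?thesis using unique[OF b'] x by simp
      qed simp
    qed
    ultimately have "carrier ?G = {\<one>\<^bsub>?G\<^esub>, ?a}"
      using one unfolding map_aut_simps by blast
    moreover have "?a \<noteq> \<one>\<^bsub>?G\<^esub>" by (simp add: affine_aut_eq_iff flip: affine_aut_id)
    ultimately show ?thesis by (rule group_of_two_elements_iso[OF group_map_aut])
  qed
  show "trivial_group ?G \<longleftrightarrow> \<not> odd_symmetric f" "?G \<cong> integer_mod_group 2 \<longleftrightarrow> odd_symmetric f"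
    using trivial Z2 trivial_group_not_iso_Z2 by blast+
qed

lemma odd_symmetric_add_const: "odd_symmetric (\<lambda>u. f u + c) \<longleftrightarrow> odd_symmetric f"
proof
  assume "odd_symmetric (\<lambda>u. f u + c)"
  then obtain b d where *: "\<And>u. f (b - u) + c = d - (f u + c)" by (auto simp: odd_symmetric_def)
  have "f (b - u) = (d - 2 * c) - f u" for u using *[of u] by simp
  then show "odd_symmetric f" unfolding odd_symmetric_def by blast
next
  assume "odd_symmetric f"
  then obtain b d where *: "\<And>u. f (b - u) = d - f u" by (auto simp: odd_symmetric_def)
  have "f (b - u) + c = (d + 2 * c) - (f u + c)" for u using *[of u] by simp
  then show "odd_symmetric (\<lambda>u. f u + c)" unfolding odd_symmetric_def by blast
qed

lemma map_aut_moduli_point: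
  assumes "q \<in> cells" "\<phi> \<in> moduli_point q"
  shows "trivial_group (map_aut \<phi>) \<longleftrightarrow> \<not> odd_symmetric (point_map q)"
    "map_aut \<phi> \<cong> integer_mod_group 2 \<longleftrightarrow> odd_symmetric (point_map q)"
proof -
  obtain \<tau> p where \<tau>: "\<tau> \<in> slope_types" "p \<in> open_cell \<tau>" and eq: "point_map (\<tau>, p) = point_map q"
    using assms(1) by (rule open_representative) metis
  obtain c where \<phi>: "\<phi> = proj_extend (\<lambda>u. point_map q u + c)"
    using assms moduli_point_eq by (auto simp: map_class_def)
  have "b = 0 \<and> d = 0" if "\<And>u. point_map q (u + b) + c = point_map q u + c + d" for b d
  proof -
    have "broken_line \<tau> (break_point p) (u + b) = broken_line \<tau> (break_point p) u + d" for u
    proof -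
      have "point_map (\<tau>, p) (u + b) = point_map (\<tau>, p) u + d" using that[of u] unfolding eq by simp
      then show ?thesis by (simp add: point_map_def)
    qed
    then show ?thesis
      using broken_line_translation[OF \<tau>(1) strict_mono_break_point[OF \<tau>(2)]] by blast
  qed
  from map_aut_dichotomy[of "\<lambda>u. point_map q u + c", OF this]
  show "trivial_group (map_aut \<phi>) \<longleftrightarrow> \<not> odd_symmetric (point_map q)"
    "map_aut \<phi> \<cong> integer_mod_group 2 \<longleftrightarrow> odd_symmetric (point_map q)"
    by (simp_all add: \<phi> odd_symmetric_add_const)
qed


section \<open>Symmetry in terms of slopes and gaps\<close>

text \<open>
  A symmetry exchanges the first and the last break point, so its centre is known.
\<close>

lemma odd_symmetric_open_iff:
  assumes "\<tau> \<in> slope_types" "p \<in> open_cell \<tau>"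
  shows "odd_symmetric (point_map (\<tau>, p)) \<longleftrightarrow> rev \<tau> = \<tau> \<and>
    (\<forall>i\<in>{1..nbreaks \<tau>}. break_point p i + break_point p (Suc (nbreaks \<tau>) - i)
       = first_break (\<tau>, p) + last_break (\<tau>, p))" (is "_ \<longleftrightarrow> _ \<and> ?breaks")
    "odd_symmetric (point_map (\<tau>, p)) \<Longrightarrow>
      \<exists>c. \<forall>u. point_map (\<tau>, p) (first_break (\<tau>, p) + last_break (\<tau>, p) - u) = c - point_map (\<tau>, p) u"
proof -
  note reflection = reflection_iff_symmetric_breaks[OF assms(1) strict_mono_break_point[OF assms(2)]]
  let ?k = "nbreaks \<tau>" and ?s = "first_break (\<tau>, p) + last_break (\<tau>, p)"
  have reflects: "rev \<tau> = \<tau>" ?breaks "b = ?s"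
    if b: "\<forall>u. point_map (\<tau>, p) (b - u) = c - point_map (\<tau>, p) u" for b c
  proof -
    have *: "rev \<tau> = \<tau>" "\<forall>i\<in>{1..?k}. break_point p i = b - break_point p (Suc ?k - i)"
      using reflection b by (auto simp: point_map_def)
    have "1 \<in> {1..?k}" using slope_typesD(9)[OF assms(1)] by simp
    then show "b = ?s" using * by (auto simp: first_break_def last_break_def)
    with * show "rev \<tau> = \<tau>" ?breaks by auto
  qed
  have "\<exists>c. \<forall>u. point_map (\<tau>, p) (?s - u) = c - point_map (\<tau>, p) u" if "rev \<tau> = \<tau>" ?breaks
    unfolding point_map_def fst_conv snd_conv reflection using that by force
  then show iff: "odd_symmetric (point_map (\<tau>, p)) \<longleftrightarrow> rev \<tau> = \<tau> \<and> ?breaks"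
    using reflects unfolding odd_symmetric_def by blast
  show "odd_symmetric (point_map (\<tau>, p)) \<Longrightarrow>
      \<exists>c. \<forall>u. point_map (\<tau>, p) (?s - u) = c - point_map (\<tau>, p) u"
    using reflects unfolding odd_symmetric_def by blast
qed

text \<open>
  With the centre expressed through the extreme breaks, symmetry becomes a family of
  equations between continuous functions on the cell; this shows it to be a closed condition,
  on the faces as well as in the interior.
\<close>

lemma odd_symmetric_about_centre:
  assumes "q \<in> cells"
  shows "odd_symmetric (point_map q) \<longleftrightarrow>
    (\<forall>u. point_map q (first_break q + last_break q - u) + point_map q u
       = point_map q (first_break q + last_break q) + point_map q 0)" (is "_ \<longleftrightarrow> ?centre")
proof
  assume sym: "odd_symmetric (point_map q)"
  obtain \<tau> p where \<tau>: "\<tau> \<in> slope_types" "p \<in> open_cell \<tau>" and eq: "point_map (\<tau>, p) = point_map q"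
    "first_break (\<tau>, p) = first_break q" "last_break (\<tau>, p) = last_break q"
    using assms by (rule open_representative) metis
  obtain c where c: "\<And>u. point_map q (first_break q + last_break q - u) = c - point_map q u"
    using odd_symmetric_open_iff(2)[OF \<tau>] sym unfolding eq by blast
  show ?centre using c c[of 0] by simp
next
  assume ?centre
  then show "odd_symmetric (point_map q)"
    unfolding odd_symmetric_def
    by (intro exI[of _ "first_break q + last_break q"]
        exI[of _ "point_map q (first_break q + last_break q) + point_map q 0"]) (simp add: algebra_simps)
qed

lemma break_point_numeral:
  "break_point p 2 = snd p + fst p 1" "break_point p 3 = snd p + fst p 1 + fst p 2"
  "break_point p 4 = snd p + fst p 1 + fst p 2 + fst p 3"
  by (simp_all add: break_point_def eval_nat_numeral)

text \<open>
  With two breaks, mirror symmetry of the breaks is automatic. With four it says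
  \<open>x 2 + x 3 = x 1 + x 4\<close>, that is, equality of the outer gaps.
\<close>

lemma odd_symmetric_open_cell:
  assumes "\<tau> \<in> slope_types" "(l, t) \<in> open_cell \<tau>"
  shows "odd_symmetric (point_map (\<tau>, l, t)) \<longleftrightarrow> rev \<tau> = \<tau> \<and> (nbreaks \<tau> = 4 \<longrightarrow> l 1 = l 3)"
proof -
  let ?k = "nbreaks \<tau>" and ?x = "break_point (l, t)"
  have "(\<forall>i\<in>{1..?k}. ?x i + ?x (Suc ?k - i) = ?x 1 + ?x ?k) \<longleftrightarrow> (?k = 4 \<longrightarrow> l 1 = l 3)"
    if "?k = 2 \<or> ?k = 4"
    using that
  proof
    assume k: "?k = 2"
    have "{1..2::nat} = {1, 2}" by auto
    then show ?thesis unfolding k by simp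
  next
    assume k: "?k = 4"
    have "{1..4::nat} = {1, 2, 3, 4}" by auto
    then show ?thesis unfolding k by (simp add: break_point_numeral)
  qed
  then show ?thesis
    unfolding odd_symmetric_open_iff[OF assms] first_break_def last_break_def fst_conv snd_conv
    using palindromic_nbreaks[OF assms(1)] by blast
qed

lemma two_break_types_iff:
  "\<tau> \<in> slope_types \<and> nbreaks \<tau> = 2 \<longleftrightarrow> \<tau> = [3, 5, 3] \<or> \<tau> = [3, 1, 3]"
  using two_break_types by blast

lemma two_break_palindromic:
  assumes "\<tau> \<in> slope_types" "nbreaks \<tau> = 2"
  shows "rev \<tau> = \<tau>"
  using conjI[OF assms] unfolding two_break_types_iff by auto

lemma moduli_point_nonempty: "q \<in> cells \<Longrightarrow> moduli_point q \<noteq> {}"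
  by (simp add: moduli_point_eq map_class_def)

lemma generic_stratum_iff:
  "q \<in> cells \<Longrightarrow> moduli_point q \<in> generic_stratum \<longleftrightarrow> \<not> odd_symmetric (point_map q)"
  using moduli_point_nonempty[of q] map_aut_moduli_point(1)[of q] moduli_point_in_quotient[of q]
  unfolding generic_stratum_def by blast

lemma symmetric_stratum_iff:
  assumes "\<tau> \<in> slope_types" "(l, t) \<in> open_cell \<tau>"
  shows "moduli_point (\<tau>, l, t) \<in> symmetric_stratum \<longleftrightarrow> nbreaks \<tau> = 4 \<and> rev \<tau> = \<tau> \<and> l 1 = l 3"
proof
  assume "moduli_point (\<tau>, l, t) \<in> symmetric_stratum"
  then obtain \<tau>' l' t' where "\<tau>' \<in> slope_types" "nbreaks \<tau>' = 4" "rev \<tau>' = \<tau>'" "(l', t') \<in> open_cell \<tau>'"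
    "l' 1 = l' 3" "moduli_point (\<tau>, l, t) = moduli_point (\<tau>', l', t')"
    by (auto simp: symmetric_stratum_def)
  then show "nbreaks \<tau> = 4 \<and> rev \<tau> = \<tau> \<and> l 1 = l 3"
    using moduli_point_unique[OF assms, of \<tau>' "(l', t')"] by auto
qed (use assms in \<open>auto simp: symmetric_stratum_def\<close>)

lemma symmetric_boundary_eq:
  "symmetric_boundary = {moduli_point (\<tau>, p) |\<tau> p. \<tau> \<in> slope_types \<and> nbreaks \<tau> = 2 \<and> p \<in> open_cell \<tau>}"
  using two_break_types unfolding symmetric_boundary_def by blast

lemma symmetric_boundary_iff:
  assumes "\<tau> \<in> slope_types" "p \<in> open_cell \<tau>"
  shows "moduli_point (\<tau>, p) \<in> symmetric_boundary \<longleftrightarrow> nbreaks \<tau> = 2"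
proof
  assume "moduli_point (\<tau>, p) \<in> symmetric_boundary"
  then obtain \<tau>' p' where "\<tau>' \<in> slope_types" "nbreaks \<tau>' = 2" "p' \<in> open_cell \<tau>'"
    "moduli_point (\<tau>, p) = moduli_point (\<tau>', p')"
    unfolding symmetric_boundary_eq by blast
  then show "nbreaks \<tau> = 2"
    using moduli_point_unique[OF assms, of \<tau>' p'] by auto
next
  assume "nbreaks \<tau> = 2"
  with assms show "moduli_point (\<tau>, p) \<in> symmetric_boundary"
    unfolding symmetric_boundary_eq by blast
qed

text \<open>
  A palindromic type has two or four breaks, so the symmetric points are those of the
  two strata.
\<close>

lemma symmetric_strata_iff:
  assumes "q \<in> cells"
  shows "moduli_point q \<in> symmetric_stratum \<union> symmetric_boundary \<longleftrightarrow> odd_symmetric (point_map q)"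
proof -
  obtain \<tau> p where \<tau>: "\<tau> \<in> slope_types" "p \<in> open_cell \<tau>" and eq: "point_map (\<tau>, p) = point_map q"
    "moduli_point (\<tau>, p) = moduli_point q"
    using assms by (rule open_representative) metis
  obtain l t where p: "p = (l, t)" by (cases p)
  show ?thesis
    unfolding eq[symmetric] p Un_iff odd_symmetric_open_cell[OF \<tau>[unfolded p]]
      symmetric_stratum_iff[OF \<tau>[unfolded p]] symmetric_boundary_iff[OF \<tau>[unfolded p]]
    using palindromic_nbreaks[OF \<tau>(1)] two_break_palindromic[OF \<tau>(1)] by auto
qed

lemma point_map_two_breaks:
  "point_map ([3, 3 + 2 * d, 3], p) u
    = 3 * u + 2 * of_int d * (max 0 (u - first_break ([3, 3 + 2 * d, 3], p)) - max 0 (u - last_break ([3, 3 + 2 * d, 3], p)))"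
  by (simp add: point_map_def broken_line_def first_break_def last_break_def nbreaks_def jump_def
      numeral_2_eq_2 algebra_simps)

text \<open>
  Also on the faces, the points of the boundary are recognized by a closed condition: the
  broken line differs from \<open>3 * u\<close> by plus or minus twice the difference of the ramps at its
  extreme breaks.
\<close>

lemma symmetric_boundary_iff_shape:
  assumes "q \<in> cells"
  shows "moduli_point q \<in> symmetric_boundary \<longleftrightarrow> (\<exists>d\<in>{1, -1::int}. \<forall>u. point_map q u
    = 3 * u + 2 * of_int d * (max 0 (u - first_break q) - max 0 (u - last_break q)))"
    (is "_ \<longleftrightarrow> ?shape")
proof -
  obtain \<tau> p where \<tau>: "\<tau> \<in> slope_types" "p \<in> open_cell \<tau>" and eq: "point_map (\<tau>, p) = point_map q"
    "moduli_point (\<tau>, p) = moduli_point q"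
    "first_break (\<tau>, p) = first_break q" "last_break (\<tau>, p) = last_break q"
    using assms by (rule open_representative) metis
  show ?thesis
  proof
    assume "moduli_point q \<in> symmetric_boundary"
    then have "nbreaks \<tau> = 2" using symmetric_boundary_iff[OF \<tau>] eq(2) by simp
    then have "\<tau> = [3, 3 + 2 * 1, 3] \<or> \<tau> = [3, 3 + 2 * (-1), 3]"
      using two_break_types_iff[of \<tau>] \<tau>(1) by simp
    then obtain d where d: "d \<in> {1, -1}" and \<tau>d: "\<tau> = [3, 3 + 2 * d, 3]" by blast
    show ?shape
      using d point_map_two_breaks[of d p] unfolding \<tau>d[symmetric] eq by blast
  next
    assume ?shape
    then obtain d where d: "d \<in> {1, -1::int}" and shape: "\<And>u. point_map q u
        = 3 * u + 2 * of_int d * (max 0 (u - first_break q) - max 0 (u - last_break q))" by blast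
    define \<tau>' where "\<tau>' = [3, 3 + 2 * d, 3]"
    define p' where "p' = ((\<lambda>i::nat. if i = 1 then last_break q - first_break q else 0), first_break q)"
    (* the equation alone would allow equal breaks; this is excluded as there are at least two *)
    have "first_break (\<tau>, p) < last_break (\<tau>, p)"
      unfolding first_break_def last_break_def fst_conv snd_conv
      using slope_typesD(9)[OF \<tau>(1)] by (intro strict_mono_onD[OF strict_mono_break_point[OF \<tau>(2)]]) auto
    then have p': "p' \<in> open_cell \<tau>'"
      unfolding eq by (auto simp: open_cell_def p'_def \<tau>'_def nbreaks_def)
    have \<tau>': "\<tau>' \<in> slope_types \<and> nbreaks \<tau>' = 2"
      unfolding two_break_types_iff using d by (auto simp: \<tau>'_def)
    have ends: "first_break (\<tau>', p') = first_break q" "last_break (\<tau>', p') = last_break q"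
      by (simp_all add: first_break_def last_break_def p'_def \<tau>'_def nbreaks_def break_point_numeral
          flip: numeral_2_eq_2)
    have "point_map (\<tau>', p') = point_map q"
      using point_map_two_breaks[of d p'] unfolding \<tau>'_def[symmetric] ends shape[symmetric] by blast
    then have "moduli_point (\<tau>', p') = moduli_point q"
      using assms open_cells[of \<tau>' p'] \<tau>' p' by (simp add: moduli_point_eq)
    then show "moduli_point q \<in> symmetric_boundary"
      using symmetric_boundary_iff[of \<tau>' p'] \<tau>' p' by simp
  qed
qed


section \<open>Closed sets and limits in the moduli space\<close>

lemma topspace_cells_topology: "topspace cells_topology = cells"
  by (simp add: cells_topology_def cells_def o_def)

lemma topspace_moduli_space: "topspace moduli_space = deg3_maps // postcomp_rel"
proof
  have "{q \<in> topspace cells_topology. moduli_point q \<in> deg3_maps // postcomp_rel} = topspace cells_topology"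
    using moduli_point_in_quotient by (auto simp: topspace_cells_topology)
  then have "openin moduli_space (deg3_maps // postcomp_rel)"
    by (simp add: openin_moduli_space)
  then show "deg3_maps // postcomp_rel \<subseteq> topspace moduli_space" by (rule openin_subset)
  show "topspace moduli_space \<subseteq> deg3_maps // postcomp_rel"
    using openin_moduli_space openin_topspace by blast
qed

text \<open>
  Closedness in the quotient topology may be tested on each partially closed cell.
\<close>

lemma closedin_moduli_space:
  assumes "Z \<subseteq> deg3_maps // postcomp_rel"
    "\<And>\<tau>. \<tau> \<in> slope_types \<Longrightarrow>
      closedin (top_of_set (partial_closed_cell \<tau>)) {p \<in> partial_closed_cell \<tau>. moduli_point (\<tau>, p) \<in> Z}"
  shows "closedin moduli_space Z"
proof -
  have "closedin cells_topology {q \<in> cells. moduli_point q \<in> Z}"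
    using assms(2) by (auto simp: cells_topology_def closedin_sum_topology cells_def)
  then have "openin cells_topology (topspace cells_topology - {q \<in> cells. moduli_point q \<in> Z})"
    by (simp add: closedin_def)
  moreover have "topspace cells_topology - {q \<in> cells. moduli_point q \<in> Z}
      = {q \<in> topspace cells_topology. moduli_point q \<in> deg3_maps // postcomp_rel - Z}"
    using moduli_point_in_quotient by (auto simp: topspace_cells_topology)
  ultimately show ?thesis
    using assms(1) by (auto simp: closedin_def openin_moduli_space topspace_moduli_space)
qed

lemma continuous_on_break_point [continuous_intros]:
  "continuous_on A (\<lambda>p. break_point p i)"
proof -
  have gap: "continuous_on A (\<lambda>p::cell_point. fst p j)" for j
    by (rule continuous_on_product_then_coordinatewise[OF continuous_on_fst]) (rule continuous_on_id)
  have first: "continuous_on A (\<lambda>p::cell_point. snd p)"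
    by (rule continuous_on_snd) (rule continuous_on_id)
  show ?thesis
    unfolding break_point_def by (intro continuous_on_add continuous_on_sum gap first)
qed

lemma continuous_on_first_last_break [continuous_intros]:
  "continuous_on A (\<lambda>p. first_break (\<tau>, p))" "continuous_on A (\<lambda>p. last_break (\<tau>, p))"
  unfolding first_break_def last_break_def fst_conv snd_conv by (rule continuous_on_break_point)+

lemma continuous_on_point_map [continuous_intros]:
  assumes "continuous_on A g"
  shows "continuous_on A (\<lambda>p. point_map (\<tau>, p) (g p))"
  unfolding point_map_def broken_line_def fst_conv snd_conv using assms by (intro continuous_intros)

lemma closedin_symmetric_strata: "closedin moduli_space (symmetric_stratum \<union> symmetric_boundary)"
proof (rule closedin_moduli_space)
  show "symmetric_stratum \<union> symmetric_boundary \<subseteq> deg3_maps // postcomp_rel"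
    unfolding deg3_quotient symmetric_boundary_eq symmetric_stratum_def by blast
  fix \<tau> assume \<tau>: "\<tau> \<in> slope_types"
  let ?s = "\<lambda>p. first_break (\<tau>, p) + last_break (\<tau>, p)"
  let ?Z = "\<lambda>u. {p. point_map (\<tau>, p) (?s p - u) + point_map (\<tau>, p) u
      = point_map (\<tau>, p) (?s p) + point_map (\<tau>, p) 0}"
  have "{p \<in> partial_closed_cell \<tau>. moduli_point (\<tau>, p) \<in> symmetric_stratum \<union> symmetric_boundary}
      = partial_closed_cell \<tau> \<inter> (\<Inter>u. ?Z u)"
  proof -
    have "moduli_point (\<tau>, p) \<in> symmetric_stratum \<union> symmetric_boundary \<longleftrightarrow> p \<in> (\<Inter>u. ?Z u)"
      if "p \<in> partial_closed_cell \<tau>" for p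
    proof -
      have "(\<tau>, p) \<in> cells" using \<tau> that by (simp add: cells_def)
      from symmetric_strata_iff[OF this] odd_symmetric_about_centre[OF this] show ?thesis by simp
    qed
    then show ?thesis by blast
  qed
  moreover have "closed (\<Inter>u. ?Z u)"
    by (intro closed_INT ballI closed_Collect_eq continuous_intros)
  ultimately show "closedin (top_of_set (partial_closed_cell \<tau>))
      {p \<in> partial_closed_cell \<tau>. moduli_point (\<tau>, p) \<in> symmetric_stratum \<union> symmetric_boundary}"
    by (simp add: closedin_closed_Int)
qed

lemma closedin_symmetric_boundary: "closedin moduli_space symmetric_boundary"
proof (rule closedin_moduli_space)
  show "symmetric_boundary \<subseteq> deg3_maps // postcomp_rel"
    unfolding deg3_quotient symmetric_boundary_eq by blast
  fix \<tau> assume \<tau>: "\<tau> \<in> slope_types"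
  let ?Z = "\<lambda>d u. {p. point_map (\<tau>, p) u
      = 3 * u + 2 * of_int d * (max 0 (u - first_break (\<tau>, p)) - max 0 (u - last_break (\<tau>, p)))}"
  have "{p \<in> partial_closed_cell \<tau>. moduli_point (\<tau>, p) \<in> symmetric_boundary}
      = partial_closed_cell \<tau> \<inter> (\<Union>d\<in>{1, -1}. \<Inter>u. ?Z d u)"
  proof -
    have "moduli_point (\<tau>, p) \<in> symmetric_boundary \<longleftrightarrow> p \<in> (\<Union>d\<in>{1, -1}. \<Inter>u. ?Z d u)"
      if "p \<in> partial_closed_cell \<tau>" for p
    proof -
      have "(\<tau>, p) \<in> cells" using \<tau> that by (simp add: cells_def)
      from symmetric_boundary_iff_shape[OF this] show ?thesis by simp
    qed
    then show ?thesis by blast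
  qed
  moreover have "closed (\<Union>d\<in>{1, -1}. \<Inter>u. ?Z d u)"
    by (intro closed_UN closed_INT ballI closed_Collect_eq continuous_intros) simp
  ultimately show "closedin (top_of_set (partial_closed_cell \<tau>))
      {p \<in> partial_closed_cell \<tau>. moduli_point (\<tau>, p) \<in> symmetric_boundary}"
    by (simp add: closedin_closed_Int)
qed

text \<open>
  Limits along paths in a single cell, possibly ending on a glued face, suffice for the
  frontier condition.
\<close>

lemma path_limit_in_closure:
  assumes \<tau>: "\<tau> \<in> slope_types" and cont: "continuous_on {0..} \<gamma>"
    and cell: "\<And>s::real. 0 \<le> s \<Longrightarrow> \<gamma> s \<in> partial_closed_cell \<tau>"
    and T: "\<And>s. 0 < s \<Longrightarrow> moduli_point (\<tau>, \<gamma> s) \<in> T"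
  shows "moduli_point (\<tau>, \<gamma> 0) \<in> moduli_space closure_of T"
  unfolding in_closure_of
proof (intro conjI allI impI)
  show "moduli_point (\<tau>, \<gamma> 0) \<in> topspace moduli_space"
    using \<tau> cell[of 0] moduli_point_in_quotient by (simp add: topspace_moduli_space cells_def)
  fix U assume U: "moduli_point (\<tau>, \<gamma> 0) \<in> U \<and> openin moduli_space U"
  let ?V = "{p \<in> partial_closed_cell \<tau>. moduli_point (\<tau>, p) \<in> U}"
  let ?W = "{q \<in> topspace cells_topology. moduli_point q \<in> U}"
  have "openin cells_topology ?W" using U openin_moduli_space by blast
  then have "openin (top_of_set (partial_closed_cell \<tau>)) {p. (\<tau>, p) \<in> ?W}"
    using \<tau> by (auto simp: cells_topology_def openin_sum_topology)
  moreover have "{p. (\<tau>, p) \<in> ?W} = ?V"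
    using \<tau> by (auto simp: topspace_cells_topology cells_def)
  ultimately have "openin (top_of_set (partial_closed_cell \<tau>)) ?V" by simp
  then have "openin (top_of_set {0..}) ({0..} \<inter> \<gamma> -` ?V)"
    using cell by (intro continuous_openin_preimage[OF cont]) auto
  moreover have "0 \<in> {0..} \<inter> \<gamma> -` ?V" using U cell[of 0] by auto
  ultimately obtain e where "e > 0" and e: "ball 0 e \<inter> {0..} \<subseteq> {0..} \<inter> \<gamma> -` ?V"
    unfolding openin_contains_ball by blast
  then have "e / 2 \<in> {0..} \<inter> \<gamma> -` ?V" by (intro subsetD[OF e]) auto
  then show "\<exists>y. y \<in> T \<and> y \<in> U" using T[of "e / 2"] \<open>e > 0\<close> by auto
qed

text \<open>
  Lengthening the first gap destroys the symmetry.
\<close>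

lemma symmetric_in_closure_generic: "symmetric_stratum \<subseteq> moduli_space closure_of generic_stratum"
proof
  fix c assume "c \<in> symmetric_stratum"
  then obtain \<tau> l t where \<tau>: "\<tau> \<in> slope_types" "nbreaks \<tau> = 4" and l: "(l, t) \<in> open_cell \<tau>" "l 1 = l 3"
    and c: "c = moduli_point (\<tau>, l, t)"
    by (auto simp: symmetric_stratum_def)
  define \<gamma> where "\<gamma> s = (l(1 := l 1 + s), t)" for s :: real
  have open_cell: "\<gamma> s \<in> open_cell \<tau>" if "0 \<le> s" for s
    using l(1) \<tau>(2) that by (auto simp: open_cell_def \<gamma>_def intro: add_pos_nonneg)
  have "continuous_on {0..} (\<lambda>s. if i = 1 then l 1 + s else l i)" for i
    by (cases "i = 1") (auto intro!: continuous_intros)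
  then have cont: "continuous_on {0..} \<gamma>"
    unfolding \<gamma>_def fun_upd_def
    by (intro continuous_on_Pair continuous_on_const continuous_on_coordinatewise_then_product)
  have "moduli_point (\<tau>, \<gamma> s) \<in> generic_stratum" if "0 < s" for s
  proof -
    have "\<not> odd_symmetric (point_map (\<tau>, \<gamma> s))"
      using odd_symmetric_open_cell[of \<tau> "l(1 := l 1 + s)" t] \<tau> l(2) open_cell[of s] that by (simp add: \<gamma>_def)
    then show ?thesis
      using generic_stratum_iff open_cells[OF \<tau>(1) open_cell[of s]] that by simp
  qed
  from path_limit_in_closure[OF \<tau>(1) cont subsetD[OF open_cell_subset open_cell] this]
  show "c \<in> moduli_space closure_of generic_stratum" by (simp add: c \<gamma>_def)
qed

text \<open>
  Splitting both double jumps into two single ones at the same distance \<open>s\<close> gives symmetric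
  maps with four breaks, which degenerate to the given map for \<open>s \<rightarrow> 0\<close>.
\<close>

lemma boundary_in_closure_symmetric: "symmetric_boundary \<subseteq> moduli_space closure_of symmetric_stratum"
proof
  fix c assume "c \<in> symmetric_boundary"
  then obtain \<tau> p where "\<tau> = [3, 3 + 2 * 1, 3] \<or> \<tau> = [3, 3 + 2 * (-1), 3]"
    and p: "p \<in> open_cell \<tau>" and c: "c = moduli_point (\<tau>, p)"
    unfolding symmetric_boundary_def by auto
  then obtain d where d: "d \<in> {1, -1::int}" and \<tau>d: "\<tau> = [3, 3 + 2 * d, 3]" by blast
  then have \<tau>: "\<tau> \<in> slope_types" using two_break_types_iff[of \<tau>] by auto
  define \<sigma> where "\<sigma> = [3, 3 + d, 3 + 2 * d, 3 + d, 3]"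
  have \<sigma>: "\<sigma> \<in> slope_types" "nbreaks \<sigma> = 4" "rev \<sigma> = \<sigma>"
    using d four_break_types by (auto simp: \<sigma>_def nbreaks_def)
  have jumps: "jump \<sigma> 1 = d" "jump \<sigma> 2 = d" "jump \<sigma> 3 = - d" "jump \<sigma> 4 = - d"
    by (simp_all add: \<sigma>_def jump_def eval_nat_numeral)
  have p1: "fst p 1 > 0" using p by (auto simp: open_cell_def \<tau>d nbreaks_def)
  (* the two outer gaps are s and close up at s = 0; the middle gap is the one of p *)
  define l where "l s = (\<lambda>i::nat. if i = 1 \<or> i = 3 then s else if i = 2 then fst p 1 else 0)" for s :: real
  define \<gamma> where "\<gamma> s = (l s, snd p)" for s
  have gaps: "{1..<4::nat} = {1, 2, 3}" by auto
  have closed_cell: "\<gamma> s \<in> partial_closed_cell \<sigma>" if "0 \<le> s" for s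
    using that p1 d jumps
    by (auto simp: partial_closed_cell_def \<sigma>(2) gaps \<gamma>_def l_def eval_nat_numeral)
  have open_cell: "(l s, snd p) \<in> open_cell \<sigma>" if "0 < s" for s
    using that p1 by (auto simp: open_cell_def \<sigma>(2) gaps l_def)
  have "continuous_on {0..} (\<lambda>s. l s i)" for i
    unfolding l_def by (cases "i = 1 \<or> i = 3") (auto intro!: continuous_intros)
  then have cont: "continuous_on {0..} \<gamma>"
    unfolding \<gamma>_def
    by (intro continuous_on_Pair continuous_on_const continuous_on_coordinatewise_then_product)
  have "moduli_point (\<sigma>, \<gamma> s) \<in> symmetric_stratum" if "0 < s" for s
    unfolding \<gamma>_def symmetric_stratum_iff[OF \<sigma>(1) open_cell[OF that]] using \<sigma> by (simp add: l_def)
  from path_limit_in_closure[OF \<sigma>(1) cont closed_cell this]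
  have "moduli_point (\<sigma>, \<gamma> 0) \<in> moduli_space closure_of symmetric_stratum" .
  moreover have "point_map (\<sigma>, \<gamma> 0) = point_map (\<tau>, p)"
  proof
    fix u
    have breaks: "{1..4::nat} = {1, 2, 3, 4}" by auto
    have "point_map (\<sigma>, \<gamma> 0) u
        = 3 * u + 2 * of_int d * (max 0 (u - snd p) - max 0 (u - (snd p + fst p 1)))"
      unfolding point_map_def broken_line_def fst_conv snd_conv \<sigma>(2) breaks
      by (simp add: jumps[simplified] break_point_numeral \<gamma>_def l_def algebra_simps)
    also have "\<dots> = point_map (\<tau>, p) u"
      unfolding \<tau>d point_map_two_breaks
      by (simp add: first_break_def last_break_def nbreaks_def break_point_numeral flip: numeral_2_eq_2)
    finally show "point_map (\<sigma>, \<gamma> 0) u = point_map (\<tau>, p) u" .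
  qed
  then have "moduli_point (\<sigma>, \<gamma> 0) = moduli_point (\<tau>, p)"
    using open_cells[OF \<tau> p] closed_cell[of 0] \<sigma>(1) by (simp add: moduli_point_eq cells_def)
  ultimately show "c \<in> moduli_space closure_of symmetric_stratum" by (simp add: c)
qed


section \<open>Dimensions of the strata\<close>

lemma stratum_dim_eqI:
  assumes "\<And>\<tau>. \<tau> \<in> slope_types \<Longrightarrow> cell_dim {p \<in> open_cell \<tau>. moduli_point (\<tau>, p) \<in> S} \<le> d"
    and "\<tau> \<in> slope_types" "cell_dim {p \<in> open_cell \<tau>. moduli_point (\<tau>, p) \<in> S} = d"
  shows "stratum_dim S = d"
  unfolding stratum_dim_def
  by (rule Max_eqI) (use assms finite_slope_types in auto)

text \<open>
  The dimensions are obtained by parametrizing the parts of the cells linearly by open sets.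
\<close>

lemma aff_dim_linear_parametrization:
  fixes f :: "'a::euclidean_space \<Rightarrow> 'b::euclidean_space"
  assumes "linear f" "inj f" "open S" "S \<noteq> {}"
  shows "aff_dim (f ` S) = int DIM('a)"
  using aff_dim_injective_linear_image[OF assms(1,2)] aff_dim_open[OF assms(3,4)] by simp

lemma stratum_dim_generic: "stratum_dim generic_stratum = 4"
proof (rule stratum_dim_eqI)
  (* this type is not palindromic, so its whole cell is generic *)
  let ?\<tau> = "[3,4,3,2,3] :: int list"
  show "cell_dim {p \<in> open_cell \<tau>. moduli_point (\<tau>, p) \<in> generic_stratum} \<le> 4" for \<tau>
    unfolding cell_dim_def by (rule order_trans[OF aff_dim_le_DIM]) simp
  show \<tau>: "?\<tau> \<in> slope_types" by (rule four_break_types)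
  have "moduli_point (?\<tau>, p) \<in> generic_stratum" if "p \<in> open_cell ?\<tau>" for p
    using odd_symmetric_open_cell[of ?\<tau> "fst p" "snd p"] generic_stratum_iff[of "(?\<tau>, p)"]
      open_cells[OF \<tau> that] \<tau> that by simp
  then have "{p \<in> open_cell ?\<tau>. moduli_point (?\<tau>, p) \<in> generic_stratum} = open_cell ?\<tau>" by auto
  moreover have "cell_coords ` open_cell ?\<tau>
      = {z. 0 < fst z $ 1 \<and> 0 < fst z $ 2 \<and> 0 < fst z $ 3}" (is "_ = ?Z")
  proof (intro equalityI subsetI)
    fix z assume z: "z \<in> ?Z"
    define p where "p = ((\<lambda>i::nat. if i = 1 then fst z $ 1 else if i = 2 then fst z $ 2
      else if i = 3 then fst z $ 3 else 0), snd z)"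
    have "{1..<4::nat} = {1, 2, 3}" by auto
    then have "p \<in> open_cell ?\<tau>" using z by (auto simp: open_cell_def nbreaks_def p_def)
    moreover have "cell_coords p = z"
      by (auto simp: cell_coords_def p_def prod_eq_iff vec_eq_iff forall_3)
    ultimately show "z \<in> cell_coords ` open_cell ?\<tau>" by blast
  qed (auto simp: cell_coords_def open_cell_def nbreaks_def)
  moreover have "aff_dim ?Z = int DIM((real^3) \<times> real)"
  proof (rule aff_dim_open)
    show "open ?Z" by (intro open_Collect_conj open_Collect_less continuous_intros)
    have "((\<chi> i. 1), 0) \<in> ?Z" by simp
    then show "?Z \<noteq> {}" by blast
  qed
  ultimately show "cell_dim {p \<in> open_cell ?\<tau>. moduli_point (?\<tau>, p) \<in> generic_stratum} = 4"
    by (simp add: cell_dim_def)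
qed

lemma stratum_dim_symmetric: "stratum_dim symmetric_stratum = 3"
proof (rule stratum_dim_eqI)
  let ?\<tau> = "[3,4,5,4,3] :: int list"
  define f :: "real \<times> real \<times> real \<Rightarrow> (real^3) \<times> real" where
    "f = (\<lambda>(a, b, t). (vector [a, b, a], t))"
  have lin: "linear f"
    by (rule linearI) (auto simp: f_def vec_eq_iff forall_3)
  have inj: "inj f"
    by (rule injI) (auto simp: f_def vec_eq_iff forall_3)
  have f: "f (fst p 1, fst p 2, snd p) = cell_coords p" if "fst p 1 = fst p 3" for p
    using that by (simp add: f_def cell_coords_def)
  have in_stratum: "moduli_point (\<tau>, p) \<in> symmetric_stratum \<longleftrightarrow> nbreaks \<tau> = 4 \<and> rev \<tau> = \<tau> \<and> fst p 1 = fst p 3"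
    if "\<tau> \<in> slope_types" "p \<in> open_cell \<tau>" for \<tau> p
    using symmetric_stratum_iff[of \<tau> "fst p" "snd p"] that by simp
  show "cell_dim {p \<in> open_cell \<tau>. moduli_point (\<tau>, p) \<in> symmetric_stratum} \<le> 3" if "\<tau> \<in> slope_types" for \<tau>
  proof -
    have "cell_coords ` {p \<in> open_cell \<tau>. moduli_point (\<tau>, p) \<in> symmetric_stratum} \<subseteq> range f"
      using in_stratum[OF that] f by (force simp flip: f)
    from aff_dim_subset[OF this] show ?thesis
      using aff_dim_linear_parametrization[OF lin inj open_UNIV] by (simp add: cell_dim_def)
  qed
  show \<tau>: "?\<tau> \<in> slope_types" by (rule four_break_types)
  let ?S = "{0<..} \<times> {0<..} \<times> UNIV :: (real \<times> real \<times> real) set"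
  have "cell_coords ` {p \<in> open_cell ?\<tau>. moduli_point (?\<tau>, p) \<in> symmetric_stratum} = f ` ?S"
  proof (intro equalityI subsetI)
    fix z assume "z \<in> f ` ?S"
    then obtain a b t where z: "z = f (a, b, t)" and ab: "a > 0" "b > 0" by auto
    define p where "p = ((\<lambda>i::nat. if i = 1 \<or> i = 3 then a else if i = 2 then b else 0), t)"
    have "{1..<4::nat} = {1, 2, 3}" by auto
    then have p: "p \<in> open_cell ?\<tau>" using ab by (auto simp: open_cell_def nbreaks_def p_def)
    moreover have "fst p 1 = fst p 3" by (simp add: p_def)
    moreover from f[OF this] have "z = cell_coords p" by (simp add: z p_def)
    ultimately show "z \<in> cell_coords ` {p \<in> open_cell ?\<tau>. moduli_point (?\<tau>, p) \<in> symmetric_stratum}"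
      using in_stratum[OF \<tau> p] by (auto simp: nbreaks_def)
  next
    fix z assume "z \<in> cell_coords ` {p \<in> open_cell ?\<tau>. moduli_point (?\<tau>, p) \<in> symmetric_stratum}"
    then obtain p where p: "p \<in> open_cell ?\<tau>" "fst p 1 = fst p 3" and z: "z = f (fst p 1, fst p 2, snd p)"
      using in_stratum[OF \<tau>] f by auto
    then show "z \<in> f ` ?S" by (auto simp: open_cell_def nbreaks_def)
  qed
  moreover have "aff_dim (f ` ?S) = 3"
  proof -
    have "open ?S" by (intro open_Times open_greaterThan open_UNIV)
    moreover have "(1, 1, 0) \<in> ?S" by simp
    ultimately show ?thesis using aff_dim_linear_parametrization[OF lin inj, of ?S] by auto
  qed
  ultimately show "cell_dim {p \<in> open_cell ?\<tau>. moduli_point (?\<tau>, p) \<in> symmetric_stratum} = 3"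
    by (simp add: cell_dim_def)
qed

lemma cell_dim_two_breaks:
  assumes "nbreaks \<tau> = 2"
  shows "cell_dim (open_cell \<tau>) = 2"
proof -
  define f :: "real \<times> real \<Rightarrow> (real^3) \<times> real" where "f = (\<lambda>(a, t). (vector [a, 0, 0], t))"
  have lin: "linear f"
    by (rule linearI) (auto simp: f_def vec_eq_iff forall_3)
  have inj: "inj f"
    by (rule injI) (auto simp: f_def vec_eq_iff forall_3)
  let ?S = "{0<..} \<times> UNIV :: (real \<times> real) set"
  have gaps: "{1..<2::nat} = {1}" by auto
  have "cell_coords ` open_cell \<tau> = f ` ?S"
  proof (intro equalityI subsetI)
    fix z assume "z \<in> f ` ?S"
    then obtain a t where z: "z = f (a, t)" and a: "a > 0" by auto
    define p where "p = ((\<lambda>i::nat. if i = 1 then a else 0), t)"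
    have "p \<in> open_cell \<tau>" using a assms gaps by (auto simp: open_cell_def p_def)
    moreover have "z = cell_coords p" by (simp add: z p_def f_def cell_coords_def)
    ultimately show "z \<in> cell_coords ` open_cell \<tau>" by blast
  next
    fix z assume "z \<in> cell_coords ` open_cell \<tau>"
    then obtain p where p: "p \<in> open_cell \<tau>" and z: "z = cell_coords p" by auto
    have "fst p 1 > 0" "fst p 2 = 0" "fst p 3 = 0"
      using p assms gaps by (auto simp: open_cell_def)
    then have "z = f (fst p 1, snd p)" "(fst p 1, snd p) \<in> ?S" by (simp_all add: z f_def cell_coords_def)
    then show "z \<in> f ` ?S" by blast
  qed
  moreover have "aff_dim (f ` ?S) = 2"
  proof -
    have "open ?S" by (intro open_Times open_greaterThan open_UNIV)
    moreover have "(1, 0) \<in> ?S" by simp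
    ultimately show ?thesis using aff_dim_linear_parametrization[OF lin inj, of ?S] by auto
  qed
  ultimately show ?thesis by (simp add: cell_dim_def)
qed

lemma stratum_dim_boundary: "stratum_dim symmetric_boundary = 2"
proof (rule stratum_dim_eqI)
  have cell: "{p \<in> open_cell \<tau>. moduli_point (\<tau>, p) \<in> symmetric_boundary}
      = (if nbreaks \<tau> = 2 then open_cell \<tau> else {})" if "\<tau> \<in> slope_types" for \<tau>
    using symmetric_boundary_iff[OF that] by auto
  show "cell_dim {p \<in> open_cell \<tau>. moduli_point (\<tau>, p) \<in> symmetric_boundary} \<le> 2"
    if "\<tau> \<in> slope_types" for \<tau>
    unfolding cell[OF that] using cell_dim_two_breaks[of \<tau>] by (simp add: cell_dim_def)
  have *: "[3,5,3] \<in> {\<tau>\<in>slope_types. nbreaks \<tau> = 2}" unfolding two_break_types by simp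
  then show "[3,5,3] \<in> slope_types" by simp
  show "cell_dim {p \<in> open_cell [3,5,3]. moduli_point ([3,5,3], p) \<in> symmetric_boundary} = 2"
    using * by (subst cell) (auto simp: cell_dim_two_breaks)
qed


section \<open>The stratification\<close>

lemma generic_stratum_eq:
  "generic_stratum = deg3_maps // postcomp_rel - (symmetric_stratum \<union> symmetric_boundary)"
proof -
  have "moduli_point (\<tau>, p) \<in> generic_stratum \<longleftrightarrow> moduli_point (\<tau>, p) \<notin> symmetric_stratum \<union> symmetric_boundary"
    if "\<tau> \<in> slope_types" "p \<in> open_cell \<tau>" for \<tau> p
    using generic_stratum_iff symmetric_strata_iff open_cells[OF that] by blast
  moreover have "generic_stratum \<subseteq> deg3_maps // postcomp_rel" by (auto simp: generic_stratum_def)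
  ultimately show ?thesis unfolding deg3_quotient by blast
qed

lemma symmetric_strata_disjoint: "symmetric_stratum \<inter> symmetric_boundary = {}"
  using symmetric_boundary_iff unfolding symmetric_stratum_def by fastforce

text \<open>
  The empty set has dimension -1.
\<close>

lemma stratum_nonempty:
  assumes "stratum_dim S \<ge> 0"
  shows "S \<noteq> {}"
proof
  assume "S = {}"
  moreover have "[3,4,5,4,3] \<in> slope_types" by (rule four_break_types)
  ultimately have "stratum_dim S = -1"
    by (intro stratum_dim_eqI[where \<tau> = "[3,4,5,4,3]"]) (simp_all add: cell_dim_def)
  with assms show False by simp
qed

text \<open>
  Both the boundary and the union of the symmetric strata are closed. This yields local
  closedness, and it shows that no stratum is met by the closure of a smaller one; the other
  direction of the frontier condition is provided by the limits
  \<open>generic \<rightarrow> symmetric \<rightarrow> boundary\<close>.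
\<close>

lemma stratification_symmetry:
  "stratification moduli_space {generic_stratum, symmetric_stratum, symmetric_boundary}"
proof -
  let ?X = moduli_space and ?G = generic_stratum and ?S = symmetric_stratum and ?B = symmetric_boundary
  have sub: "?S \<subseteq> topspace ?X" "?B \<subseteq> topspace ?X" "?G \<subseteq> topspace ?X"
    using closedin_subset[OF closedin_symmetric_strata] generic_stratum_eq by (auto simp: topspace_moduli_space)
  have G: "?G = topspace ?X - (?S \<union> ?B)" by (simp add: topspace_moduli_space generic_stratum_eq)
  have S: "?S = (topspace ?X - ?B) \<inter> (?S \<union> ?B)" using sub symmetric_strata_disjoint by auto
  have open_G: "openin ?X ?G" unfolding G using closedin_symmetric_strata by blast
  have open_notB: "openin ?X (topspace ?X - ?B)" using closedin_symmetric_boundary by blast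
  have lc: "\<exists>U C. openin ?X U \<and> closedin ?X C \<and> T = U \<inter> C" if T: "T \<in> {?G, ?S, ?B}" for T
  proof -
    consider "T = ?G" | "T = ?S" | "T = ?B" using T by blast
    then show ?thesis
    proof cases
      case 1
      then show ?thesis using open_G sub(3) by (intro exI[of _ ?G] exI[of _ "topspace ?X"]) auto
    next
      case 2
      then show ?thesis using S open_notB closedin_symmetric_strata by metis
    next
      case 3
      then show ?thesis using closedin_symmetric_boundary sub(2)
        by (intro exI[of _ "topspace ?X"] exI[of _ ?B]) auto
    qed
  qed
  have cl_B: "?X closure_of ?B = ?B" using closedin_symmetric_boundary by (rule closure_of_closedin)
  have cl_S: "?X closure_of ?S \<subseteq> ?S \<union> ?B"
    using closedin_symmetric_strata by (intro closure_of_minimal) auto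
  have S_cl_G: "?S \<subseteq> ?X closure_of ?G" by (rule symmetric_in_closure_generic)
  have B_cl_S: "?B \<subseteq> ?X closure_of ?S" by (rule boundary_in_closure_symmetric)
  have B_cl_G: "?B \<subseteq> ?X closure_of ?G"
    using B_cl_S closure_of_mono[OF S_cl_G, of ?X] by simp
  have self: "?G \<subseteq> ?X closure_of ?G" "?S \<subseteq> ?X closure_of ?S"
    using sub closure_of_subset by blast+
  have frontier: "T \<inter> ?X closure_of T' \<noteq> {} \<longrightarrow> T \<subseteq> ?X closure_of T'"
    if T: "T \<in> {?G, ?S, ?B}" and T': "T' \<in> {?G, ?S, ?B}" for T T'
  proof -
    consider "T' = ?G" | "T' = ?S" | "T' = ?B" using T' by blast
    then show ?thesis
    proof cases
      case 1
      then show ?thesis using T self(1) S_cl_G B_cl_G by auto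
    next
      case 2
      have "?G \<inter> ?X closure_of ?S = {}" using cl_S G by blast
      then show ?thesis using 2 T self(2) B_cl_S by auto
    next
      case 3
      have "?G \<inter> ?B = {}" "?S \<inter> ?B = {}" using G symmetric_strata_disjoint by blast+
      then show ?thesis using 3 T cl_B by auto
    qed
  qed
  have ne: "{} \<notin> {?G, ?S, ?B}"
    using stratum_nonempty[of ?G] stratum_nonempty[of ?S] stratum_nonempty[of ?B]
      stratum_dim_generic stratum_dim_symmetric stratum_dim_boundary by auto
  have disj: "disjoint {?G, ?S, ?B}"
    using G symmetric_strata_disjoint by (auto simp: disjoint_def)
  have union: "\<Union>{?G, ?S, ?B} = topspace ?X" using G sub by auto
  show ?thesis
    unfolding stratification_def
    by (intro conjI ballI lc frontier ne disj union) auto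
qed

theorem theorem2:
  shows "topspace moduli_space = deg3_maps // postcomp_rel \<and>
    stratification moduli_space {generic_stratum, symmetric_stratum, symmetric_boundary} \<and>
    (\<forall>c \<in> deg3_maps // postcomp_rel. \<forall>\<phi>\<in>c.
       (c \<in> generic_stratum \<longleftrightarrow> trivial_group (map_aut \<phi>)) \<and>
       (c \<in> symmetric_stratum \<union> symmetric_boundary \<longleftrightarrow> map_aut \<phi> \<cong> integer_mod_group 2)) \<and>
    stratum_dim generic_stratum = 4 \<and>
    stratum_dim symmetric_stratum = 3 \<and>
    (\<forall>\<tau>\<in>slope_types. nbreaks \<tau> = 4 \<longrightarrow>
       (\<forall>l t. (l, t) \<in> open_cell \<tau> \<longrightarrow> (\<forall>\<phi>\<in>moduli_point (\<tau>, l, t).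
          map_aut \<phi> \<cong> integer_mod_group 2 \<longleftrightarrow> rev \<tau> = \<tau> \<and> l 1 = l 3))) \<and>
    stratum_dim symmetric_boundary = 2 \<and>
    {\<tau>\<in>slope_types. nbreaks \<tau> = 2} = {[3,5,3], [3,1,3]} \<and>
    (\<forall>\<tau>\<in>{[3,5,3], [3,1,3]}. cell_dim (open_cell \<tau>) = 2 \<and>
       (\<forall>p\<in>open_cell \<tau>. \<forall>\<phi>\<in>moduli_point (\<tau>, p). map_aut \<phi> \<cong> integer_mod_group 2))"
proof (intro conjI)
  show "\<forall>c \<in> deg3_maps // postcomp_rel. \<forall>\<phi>\<in>c.
      (c \<in> generic_stratum \<longleftrightarrow> trivial_group (map_aut \<phi>)) \<and>
      (c \<in> symmetric_stratum \<union> symmetric_boundary \<longleftrightarrow> map_aut \<phi> \<cong> integer_mod_group 2)"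
  proof (intro ballI)
    fix c \<phi> assume "c \<in> deg3_maps // postcomp_rel" "\<phi> \<in> c"
    then obtain q where "q \<in> cells" "c = moduli_point q" "\<phi> \<in> moduli_point q"
      using open_cells unfolding deg3_quotient by blast
    then show "(c \<in> generic_stratum \<longleftrightarrow> trivial_group (map_aut \<phi>)) \<and>
        (c \<in> symmetric_stratum \<union> symmetric_boundary \<longleftrightarrow> map_aut \<phi> \<cong> integer_mod_group 2)"
      using generic_stratum_iff symmetric_strata_iff map_aut_moduli_point by blast
  qed
  have two: "\<tau> \<in> slope_types" "nbreaks \<tau> = 2" if "\<tau> \<in> {[3,5,3], [3,1,3]}" for \<tau>
    using that two_break_types by blast+
  show "\<forall>\<tau>\<in>{[3,5,3], [3,1,3]}. cell_dim (open_cell \<tau>) = 2 \<and>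
       (\<forall>p\<in>open_cell \<tau>. \<forall>\<phi>\<in>moduli_point (\<tau>, p). map_aut \<phi> \<cong> integer_mod_group 2)"
  proof (intro ballI conjI)
    fix \<tau> p \<phi> assume \<tau>: "\<tau> \<in> {[3,5,3], [3,1,3::int]}" and p: "p \<in> open_cell \<tau>" and \<phi>: "\<phi> \<in> moduli_point (\<tau>, p)"
    obtain l t where "p = (l, t)" by (cases p)
    then show "map_aut \<phi> \<cong> integer_mod_group 2"
      using map_aut_moduli_point(2)[OF open_cells[OF two(1)[OF \<tau>] p] \<phi>] p
        odd_symmetric_open_cell[OF two(1)[OF \<tau>], of l t] two_break_palindromic[OF two[OF \<tau>]] two(2)[OF \<tau>]
      by simp
  qed (simp add: cell_dim_two_breaks two)
  show "\<forall>\<tau>\<in>slope_types. nbreaks \<tau> = 4 \<longrightarrow>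
       (\<forall>l t. (l, t) \<in> open_cell \<tau> \<longrightarrow> (\<forall>\<phi>\<in>moduli_point (\<tau>, l, t).
          map_aut \<phi> \<cong> integer_mod_group 2 \<longleftrightarrow> rev \<tau> = \<tau> \<and> l 1 = l 3))"
    using map_aut_moduli_point(2) odd_symmetric_open_cell open_cells by blast
qed (rule topspace_moduli_space stratification_symmetry stratum_dim_generic stratum_dim_symmetric
    stratum_dim_boundary two_break_types)+

end
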